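(* Let $p\ge 3$. Let $\mathcal{C}$ be a $C^4$ strictly convex curve, and let the initial data $\mathbf{v}^0$ on $\mathcal{C}$ contain at least $\lceil \frac p2\rceil+1$ different points. Let $T$ be a linear subdivision scheme with exact order of polynomial reproduction $P_e\ge4$ and shift parameter $c_T=c_{S_p}$. If the $(S_p,S_{p-2},T)$ normal multi-scale transform of $\mathcal{C}$ with initial data $\mathbf{v}^0$ is convergent, then its details satisfy $$\|d^j\|=\mathrm{O}(2^{-4j}),\qquad j\to\infty,$$ where $\|d^j\|=\sup_{K\in\mathbb{Z}}|d^j_K|$.
   Context: Curve. $\mathcal{C}$ is a rectifiable, non-self-intersecting, closed planar curve of length $L$, given by its regular $C^1$ arc-length parametrization $\mathbf{v}(s)$, $s\in[0,L]$, extended $L$-periodically to $\mathbb{R}$. "$\mathcal{C}$ is $C^k$" means that $\mathbf{v}$ is $C^k$ (as a periodic function). Strictly convex means that the signed curvature $\mathrm{k}(s)$ satisfies $\mathrm{k}(s)>0$ for all $s\in[0,L]$. Initial data. $\mathbf{v}^0_i=\mathbf{v}(s^0_i)$, $i=0,\dots,N-1$, with $s^0_0<s^0_1<\dots<s^0_{N-1}<s^0_0+L$, extended by $\mathbf{v}^0_{i+N}=\mathbf{v}^0_i$, $s^0_{i+N}=s^0_i+L$ for all $i\in\mathbb{Z}$ (so it contains $N$ different points). Subdivision operators. A linear subdivision scheme is a local, shift-invariant, bounded linear operator $(Tx)_i=\sum_k a_{i-2k}x_k$ with finitely supported mask $a$, acting on sequences indexed by $\mathbb{Z}$ (componentwise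 for $\mathbb{R}^2$-valued ones). $T$ has exact order of polynomial reproduction $P_e$ with shift parameter $c_T$ if $(T(\mathfrak{p}|_{\mathbb{Z}}))_i=\mathfrak{p}(i/2+c_T)$, $i\in\mathbb{Z}$, for all polynomials $\mathfrak{p}$ of degree less than $P_e$, where $\mathfrak{p}|_{\mathbb{Z}}=(\mathfrak{p}(i))_{i\in\mathbb{Z}}$. The B-spline operators are $(S_0x)_{2i}=(S_0x)_{2i+1}=x_i$ and $(S_px)_i=\frac12\big((S_{p-1}x)_i+(S_{p-1}x)_{i+1}\big)$ for $p\ge1$; $S_p$ ($p\ge1$) exactly reproduces linear polynomials with shift parameter $c_{S_p}=\frac{p-1}{4}$. Notation. $\Delta x_i=x_{i+1}-x_i$; $I=\{0,1,\dots,p+1\}$, $I_i=i+I$; $\perp$ is rotation by $\pi/2$ in a fixed direction. $(S_p,S_{p-2},T)$ normal multi-scale transform. For $j\ge1$ and $K\in\mathbb{Z}$ let $$\hat{\mathbf{n}}^j_K=\frac{(S_{p-2}\Delta\mathbf{v}^{j-1})_K^\perp}{|(S_{p-2}\Delta\mathbf{v}^{j-1})_K|},\qquad \ell^j_K(t)=(S_p\mathbf{v}^{j-1})_K+t\,\hat{\mathbf{n}}^j_K .$$ The predicted point $\hat{\mathbf{v}}^j_K$ is the orthogonal projection of $(T\mathbf{v}^{j-1})_K$ onto the line $\ell^j_K$. The new point $\mathbf{v}^j_K=\mathbf{v}(s^j_K)$ is an intersection point of $\ell^j_K$ with $\mathcal{C}$ (in case of several intersection points, one with $s^j_K\in[s^{j-1}_i,s^{j-1}_{i+p+1}]$,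 the interval spanned by $s^{j-1}|_{I_i}$, for the indices $i$ with $K\in I_{2i}\cup I_{2i+1}$), and the scalar detail $d^j_K$ is defined by $$\mathbf{v}^j_K=\hat{\mathbf{v}}^j_K+d^j_K\hat{\mathbf{n}}^j_K .$$ One has $s^j_{i+2^jN}=s^j_i+L$. The points are understood to be selected so that each $s^j$ is strictly increasing (well-posedness). The transform is convergent if the piecewise linear interpolants $s^j(t)$, with $s^j(2^{-j}i)=s^j_i$, converge uniformly as $j\to\infty$ to a continuous function $s(t)$. *)

theory Defs
  imports "HOL-Analysis.Analysis" "HOL-Library.Landau_Symbols"
    "HOL-Computational_Algebra.Polynomial"
begin

text \<open>The Euclidean plane is \<open>complex\<close>, with inner product \<open>x \<bullet> y = Re (x * cnj y)\<close>; multiplication by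
  \<open>\<i>\<close> is the rotation by \<open>\<pi>/2\<close>, counterclockwise.\<close>

fun Ck :: "nat \<Rightarrow> (real \<Rightarrow> 'a::real_normed_vector) \<Rightarrow> bool" where
  "Ck 0 f \<longleftrightarrow> continuous_on UNIV f"
| "Ck (Suc k) f \<longleftrightarrow> (\<forall>x. f differentiable at x) \<and> Ck k (\<lambda>x. vector_derivative f (at x))"

text \<open>Since \<open>v\<close> has unit speed, the period \<open>L\<close> is also the length of the curve \<open>range v\<close>.\<close>

definition closed_arclength_curve :: "(real \<Rightarrow> complex) \<Rightarrow> real \<Rightarrow> bool" where
  "closed_arclength_curve v L \<longleftrightarrow>
     L > 0 \<and> Ck 1 v \<and> (\<forall>s. norm (vector_derivative v (at s)) = 1) \<and>
     (\<forall>s. v (s + L) = v s) \<and> inj_on v {0..<L}"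

text \<open>For unit speed curves only: the curvature is the component of \<open>v''\<close> along the unit normal
  obtained by rotating \<open>v'\<close> counterclockwise.\<close>

definition signed_curvature :: "(real \<Rightarrow> complex) \<Rightarrow> real \<Rightarrow> real" where
  "signed_curvature v s =
     vector_derivative (\<lambda>t. vector_derivative v (at t)) (at s) \<bullet> (\<i> * vector_derivative v (at s))"

definition strictly_convex_curve :: "(real \<Rightarrow> complex) \<Rightarrow> real \<Rightarrow> bool" where
  "strictly_convex_curve v L \<longleftrightarrow> (\<forall>s\<in>{0..L}. signed_curvature v s > 0)"

text \<open>The subdivision operator with mask \<open>a\<close>. The sum is the full sum over \<open>k\<close> provided that \<open>a\<close> has
  finite support.\<close>

definition subdiv :: "(int \<Rightarrow> real) \<Rightarrow> (int \<Rightarrow> 'a::real_vector) \<Rightarrow> int \<Rightarrow> 'a" where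
  "subdiv a x i = (\<Sum>k | a (i - 2 * k) \<noteq> 0. a (i - 2 * k) *\<^sub>R x k)"

definition exact_reproduction :: "(int \<Rightarrow> real) \<Rightarrow> nat \<Rightarrow> real \<Rightarrow> bool" where
  "exact_reproduction a P c \<longleftrightarrow>
     (\<forall>q :: real poly. degree q < P \<longrightarrow>
        (\<forall>i. subdiv a (\<lambda>k. poly q (of_int k)) i = poly q (of_int i / 2 + c)))"

fun bspline :: "nat \<Rightarrow> (int \<Rightarrow> 'a::real_vector) \<Rightarrow> int \<Rightarrow> 'a" where
  "bspline 0 x i = x (i div 2)"
| "bspline (Suc p) x i = (1 / 2) *\<^sub>R (bspline p x i + bspline p x (i + 1))"

definition fdiff :: "(int \<Rightarrow> 'a::ab_group_add) \<Rightarrow> int \<Rightarrow> 'a" where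
  "fdiff x i = x (i + 1) - x i"

text \<open>In what follows \<open>\<omega>\<close> is \<open>\<i>\<close> or \<open>-\<i>\<close>, so that \<open>z\<^sup>\<bottom> = \<omega> * z\<close>, and \<open>x\<close> is the point sequence of
  the preceding level.\<close>

definition unit_normal :: "complex \<Rightarrow> nat \<Rightarrow> (int \<Rightarrow> complex) \<Rightarrow> int \<Rightarrow> complex" where
  "unit_normal \<omega> p x K =
     (\<omega> * bspline (p - 2) (fdiff x) K) /\<^sub>R norm (bspline (p - 2) (fdiff x) K)"

definition normal_line :: "complex \<Rightarrow> nat \<Rightarrow> (int \<Rightarrow> complex) \<Rightarrow> int \<Rightarrow> complex set" where
  "normal_line \<omega> p x K = {bspline p x K + t *\<^sub>R unit_normal \<omega> p x K | t. True}"

text \<open>The orthogonal projection of \<open>y\<close> onto the line through \<open>b\<close> with unit direction \<open>n\<close>.\<close>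

definition line_projection :: "'a::real_inner \<Rightarrow> 'a \<Rightarrow> 'a \<Rightarrow> 'a" where
  "line_projection b n y = b + ((y - b) \<bullet> n) *\<^sub>R n"

definition predicted_point ::
    "complex \<Rightarrow> nat \<Rightarrow> (int \<Rightarrow> real) \<Rightarrow> (int \<Rightarrow> complex) \<Rightarrow> int \<Rightarrow> complex" where
  "predicted_point \<omega> p a x K =
     line_projection (bspline p x K) (unit_normal \<omega> p x K) (subdiv a x K)"

definition initial_parameters :: "real \<Rightarrow> nat \<Rightarrow> (int \<Rightarrow> real) \<Rightarrow> bool" where
  "initial_parameters L N s0 \<longleftrightarrow>
     N \<ge> 1 \<and> strict_mono_on {0..<int N} s0 \<and> s0 (int N - 1) < s0 0 + L \<and>
     (\<forall>i. s0 (i + int N) = s0 i + L)"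

definition index_set :: "nat \<Rightarrow> int \<Rightarrow> int set" where
  "index_set p i = {i..i + int p + 1}"

text \<open>One step of the transform, with mask \<open>a\<close> for the predictor, from the parameters \<open>s\<close> to the
  parameters \<open>s'\<close> and the details \<open>d\<close>. The first conjunct says that the unit normals exist. The
  restriction on \<open>s' K\<close> is imposed if the line and the curve do not meet in a unique point, and
  for all indices \<open>i\<close> whose index sets cover \<open>K\<close>.\<close>

definition transform_step ::
    "complex \<Rightarrow> nat \<Rightarrow> (int \<Rightarrow> real) \<Rightarrow> (real \<Rightarrow> complex) \<Rightarrow>
     (int \<Rightarrow> real) \<Rightarrow> (int \<Rightarrow> real) \<Rightarrow> (int \<Rightarrow> real) \<Rightarrow> bool" where
  "transform_step \<omega> p a v s s' d \<longleftrightarrow>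
     (\<forall>K. bspline (p - 2) (fdiff (v \<circ> s)) K \<noteq> 0 \<and>
          v (s' K) \<in> normal_line \<omega> p (v \<circ> s) K \<and>
          ((\<nexists>!q. q \<in> normal_line \<omega> p (v \<circ> s) K \<inter> range v) \<longrightarrow>
             (\<forall>i. K \<in> index_set p (2 * i) \<union> index_set p (2 * i + 1) \<longrightarrow>
                  s' K \<in> {s i..s (i + int p + 1)})) \<and>
          v (s' K) = predicted_point \<omega> p a (v \<circ> s) K + d K *\<^sub>R unit_normal \<omega> p (v \<circ> s) K)"

text \<open>\<open>s j\<close> and \<open>d j\<close> are the parameters and the details of level \<open>j\<close>; \<open>d 0\<close> is irrelevant.\<close>

definition normal_transform ::
    "complex \<Rightarrow> nat \<Rightarrow> (int \<Rightarrow> real) \<Rightarrow> (real \<Rightarrow> complex) \<Rightarrow> real \<Rightarrow> nat \<Rightarrow>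
     (nat \<Rightarrow> int \<Rightarrow> real) \<Rightarrow> (nat \<Rightarrow> int \<Rightarrow> real) \<Rightarrow> bool" where
  "normal_transform \<omega> p a v L N s d \<longleftrightarrow>
     initial_parameters L N (s 0) \<and>
     (\<forall>j. strict_mono (s j)) \<and>
     (\<forall>j i. s j (i + 2 ^ j * int N) = s j i + L) \<and>
     (\<forall>j\<ge>1. transform_step \<omega> p a v (s (j - 1)) (s j) (d j))"

definition pl_interpolant :: "nat \<Rightarrow> (int \<Rightarrow> real) \<Rightarrow> real \<Rightarrow> real" where
  "pl_interpolant j x t =
     x \<lfloor>2 ^ j * t\<rfloor> + frac (2 ^ j * t) * (x (\<lfloor>2 ^ j * t\<rfloor> + 1) - x \<lfloor>2 ^ j * t\<rfloor>)"

definition transform_convergent :: "(nat \<Rightarrow> int \<Rightarrow> real) \<Rightarrow> bool" where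
  "transform_convergent s \<longleftrightarrow>
     (\<exists>\<sigma>. continuous_on UNIV \<sigma> \<and>
          uniform_limit UNIV (\<lambda>j. pl_interpolant j (s j)) \<sigma> sequentially)"

text \<open>A real supremum, hence meaningful only for bounded sequences; the details of each level
  \<open>j \<ge> 1\<close> are periodic and therefore bounded, see \<open>details_bounded\<close> below.\<close>

definition sup_norm :: "(int \<Rightarrow> real) \<Rightarrow> real" where
  "sup_norm x = (SUP K. \<bar>x K\<bar>)"

lemma bspline_shift: "bspline p (\<lambda>i. x (i + M)) K = bspline p x (K + 2 * M)"
  by (induction p arbitrary: K) (simp_all add: algebra_simps)

lemma subdiv_shift: "subdiv a (\<lambda>i. x (i + M)) K = subdiv a x (K + 2 * M)"
  unfolding subdiv_def
  by (rule sum.reindex_bij_witness[of _ "\<lambda>k. k - M" "\<lambda>k. k + M"]) (auto simp: algebra_simps)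

lemma details_bounded:
  assumes v: "closed_arclength_curve v L" and \<omega>: "\<omega> \<in> {\<i>, -\<i>}"
    and tr: "normal_transform \<omega> p a v L N s d" and j: "j \<ge> 1"
  shows "bdd_above (range (\<lambda>K. \<bar>d j K\<bar>))"
proof -
  define M where "M = 2 ^ (j - 1) * int N"
  define x where "x = v \<circ> s (j - 1)"
  have M2: "2 * M = 2 ^ j * int N"
    using j by (cases j) (simp_all add: M_def)
  have Mpos: "M > 0"
    using tr by (auto simp: normal_transform_def initial_parameters_def M_def)
  have step: "transform_step \<omega> p a v (s (j - 1)) (s j) (d j)"
    using tr j by (auto simp: normal_transform_def)
  have xM: "(\<lambda>i. x (i + M)) = x"
    using tr v by (auto simp: normal_transform_def closed_arclength_curve_def x_def M_def)
  have dM: "(\<lambda>i. fdiff x (i + M)) = fdiff x"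
  proof
    fix i
    show "fdiff x (i + M) = fdiff x i"
      using fun_cong[OF xM, of i] fun_cong[OF xM, of "i + 1"]
      by (simp add: fdiff_def algebra_simps)
  qed
  have S: "bspline q x (K + 2 * M) = bspline q x K" for q K
    using bspline_shift[of q x M K] xM by simp
  have D: "bspline q (fdiff x) (K + 2 * M) = bspline q (fdiff x) K" for q K
    using bspline_shift[of q "fdiff x" M K] dM by simp
  have T: "subdiv a x (K + 2 * M) = subdiv a x K" for K
    using subdiv_shift[of a x M K] xM by simp
  have n: "unit_normal \<omega> p x (K + 2 * M) = unit_normal \<omega> p x K" for K
    by (simp add: unit_normal_def D)
  have q: "predicted_point \<omega> p a x (K + 2 * M) = predicted_point \<omega> p a x K" for K
    by (simp add: predicted_point_def S T n)
  have vs: "v (s j (K + 2 * M)) = v (s j K)" for K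
    using tr v by (auto simp: normal_transform_def closed_arclength_curve_def M2)
  have eq: "v (s j K) = predicted_point \<omega> p a x K + d j K *\<^sub>R unit_normal \<omega> p x K" for K
    using step by (auto simp: transform_step_def x_def)
  have nz: "unit_normal \<omega> p x K \<noteq> 0" for K
    using step \<omega> by (auto simp: transform_step_def x_def unit_normal_def)
  have per: "d j (K + 2 * M) = d j K" for K
    using eq[of K] eq[of "K + 2 * M"] nz[of K] by (simp add: vs q n)
  have per2: "d j (K + 2 * M * int k) = d j K" for K k
  proof (induction k)
    case (Suc k)
    have "d j (K + 2 * M * int (Suc k)) = d j ((K + 2 * M * int k) + 2 * M)"
      by (simp add: algebra_simps)
    then show ?case using per[of "K + 2 * M * int k"] Suc by simp
  qed simp
  have modM: "d j K = d j (K mod (2 * M))" for K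
  proof (cases "K div (2 * M) \<ge> 0")
    case True
    then obtain k where "K div (2 * M) = int k" using nonneg_int_cases by blast
    then have "K = K mod (2 * M) + 2 * M * int k" using mod_mult_div_eq[of K "2 * M"] by simp
    then show ?thesis using per2[of "K mod (2 * M)" k] by simp
  next
    case False
    then obtain k where "K div (2 * M) = - int k"
      by (metis int_cases2 of_nat_0_le_iff)
    then have "K mod (2 * M) = K + 2 * M * int k" using mod_mult_div_eq[of K "2 * M"]
      by (simp add: algebra_simps)
    then show ?thesis using per2[of K k] by simp
  qed
  have "range (\<lambda>K. \<bar>d j K\<bar>) \<subseteq> (\<lambda>K. \<bar>d j K\<bar>) ` {0..<2 * M}"
  proof clarify
    fix K
    have "K mod (2 * M) \<in> {0..<2 * M}" using Mpos by simp
    then show "\<bar>d j K\<bar> \<in> (\<lambda>K. \<bar>d j K\<bar>) ` {0..<2 * M}"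
      using modM[of K] by (metis image_eqI)
  qed
  then show ?thesis
    by (meson bdd_above_finite finite_atLeastLessThan_int finite_imageI finite_subset)
qed

end

theory Submission
  imports Defs
begin

text \<open>Write \<open>h\<close> for the mesh width of one level and expand everything around the parameter
  \<open>\<sigma> = (S\<^sub>p s)\<^sub>K\<close>. The normalised direction \<open>S\<^sub>p\<^sub>-\<^sub>2 \<Delta>v\<close> is \<open>v'(\<sigma>) + e\<close>, and orthogonality of the
  line to it gives \<open>s'\<^sub>K - \<sigma> = O(h\<^sup>2 |e| + |m\<^sub>3| + h\<^sup>4)\<close> with \<open>m\<^sub>3\<close> the third moment of \<open>s - \<sigma>\<close>;
  convergence already guarantees that \<open>s'\<^sub>K\<close> is the intersection close to \<open>\<sigma>\<close>. A priori \<open>e = O(h)\<close> and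
  \<open>m\<^sub>3 = O(h\<^sup>3)\<close>, hence \<open>s' = S\<^sub>p s + O(h\<^sup>3)\<close>. As \<open>S\<^sub>p\<close> contracts \<open>n\<close>-th differences by \<open>2\<^sup>-\<^sup>n\<close>, this
  forces \<open>\<Delta>s = O(2\<^sup>-\<^sup>j)\<close> and \<open>\<Delta>\<^sup>2s = O(2\<^sup>-\<^sup>2\<^sup>j)\<close>. Now \<open>s\<close> is locally linear up to \<open>O(h\<^sup>2)\<close>, and
  since \<open>S\<^sub>p\<close> on nodes and \<open>S\<^sub>p\<^sub>-\<^sub>2\<close> on midpoints are centred at the same point and the third central
  moment of \<open>S\<^sub>p\<close> vanishes, \<open>e = O(h\<^sup>2)\<close>,
  \<open>m\<^sub>3 = O(h\<^sup>4)\<close> and \<open>s' = S\<^sub>p s + O(h\<^sup>4)\<close>, whence \<open>\<Delta>\<^sup>3s = O(2\<^sup>-\<^sup>3\<^sup>j)\<close>. Finally the detail is the normal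
  component of \<open>v(s'\<^sub>K) - (T v)\<^sub>K\<close>: tangential terms are damped by the factor \<open>e\<close>, and the moments of
  \<open>T\<close> annihilate the remaining terms up to \<open>O(h\<^sup>4)\<close>.\<close>

section \<open>B-spline and subdivision operators\<close>

lemma bspline_add: "bspline p (\<lambda>k. x k + y k) K = bspline p x K + bspline p y K"
  by (induction p arbitrary: K) (simp_all add: algebra_simps)

lemma bspline_diff: "bspline p (\<lambda>k. x k - y k) K = bspline p x K - bspline p y K"
  by (induction p arbitrary: K) (simp_all add: scaleR_diff_right scaleR_add_right)

lemma bspline_const: "bspline p (\<lambda>_. c) K = c"
  by (induction p arbitrary: K) (simp_all flip: scaleR_2)

lemma bspline_linear:
  assumes "linear f"
  shows "bspline p (\<lambda>k. f (x k)) K = f (bspline p x K)"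
  by (induction p arbitrary: K) (simp_all add: linear_add[OF assms] linear_scale[OF assms])

lemma bspline_mult: "bspline p (\<lambda>k. c * x k) K = c * bspline p x K" for c :: real
  by (rule bspline_linear) (simp add: linear_iff algebra_simps)

lemma bspline_scaleR: "bspline p (\<lambda>k. x k *\<^sub>R c) K = bspline p x K *\<^sub>R c"
  by (rule bspline_linear) (simp add: linear_iff algebra_simps)

text \<open>Averaging two points stays in a convex set, and the window is the range of indices on
  which the value depends. Balls give the norm bound, and the ball of radius 0 gives
  \<open>bspline_cong\<close>.\<close>

lemma bspline_in_convex:
  assumes "convex C" and "\<And>k. k \<in> {K div 2..(K + int p) div 2} \<Longrightarrow> x k \<in> C"
  shows "bspline p x K \<in> C"
  using assms(2)
proof (induction p arbitrary: K)
  case (Suc p)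
  have "bspline p x K \<in> C" "bspline p x (K + 1) \<in> C"
    by (rule Suc.IH, rule Suc.prems, simp, linarith)+
  from convexD[OF assms(1) this, of "1/2" "1/2"] show ?case
    by (simp add: scaleR_add_right)
qed simp

lemma bspline_norm_le:
  assumes "\<And>k. k \<in> {K div 2..(K + int p) div 2} \<Longrightarrow> norm (x k) \<le> B"
  shows "norm (bspline p x K) \<le> B"
  using bspline_in_convex[of "cball 0 B" K p x] assms by simp

lemma bspline_cong:
  fixes x y :: "int \<Rightarrow> 'a::real_normed_vector"
  assumes "\<And>k. k \<in> {K div 2..(K + int p) div 2} \<Longrightarrow> x k = y k"
  shows "bspline p x K = bspline p y K"
  using bspline_norm_le[of K p "\<lambda>k. x k - y k" 0] assms by (simp add: bspline_diff)

lemma bspline_fdiff: "bspline p (fdiff x) K = bspline p x (K + 2) - bspline p x K"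
  unfolding fdiff_def[abs_def] bspline_diff using bspline_shift[of p x 1 K] by simp

text \<open>The inner terms of the two averages cancel. Trading one averaging step for a difference
  and a factor 1/2 is the source of all contraction below.\<close>

lemma fdiff_bspline: "fdiff (bspline (Suc p) x) = (\<lambda>K. (1 / 2) *\<^sub>R bspline p (fdiff x) K)"
  by (rule ext) (simp add: bspline_fdiff fdiff_def algebra_simps)

text \<open>The windows at \<open>K\<close> and \<open>K + 1\<close> overlap, so the two telescoped
  sums cover the larger window and each order costs only a factor 2. For the parameters this bounds
  averaged increments from below without any assumption on mesh ratios.\<close>

lemma bspline_fdiff_ge:
  fixes s :: "int \<Rightarrow> real"
  assumes "mono s"
  shows "s ((K + int p) div 2 + 1) - s (K div 2) \<le> 2 ^ p * bspline p (fdiff s) K"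
proof (induction p arbitrary: K)
  case (Suc p)
  have "s ((K + 1) div 2) \<le> s ((K + int p) div 2 + 1)"
    by (rule monoD[OF assms]) linarith
  with Suc[of K] Suc[of "K + 1"] show ?case
    by (simp add: algebra_simps)
qed (simp add: fdiff_def)

section \<open>Moments of the B-spline weights up to order three\<close>

lemma bspline_moment_1:
  "bspline (Suc q) real_of_int K = real_of_int K / 2 + real q / 4"
proof (induction q arbitrary: K)
  case 0
  have "K div 2 + (K + 1) div 2 = K" by linarith
  then have "real_of_int (K div 2) + real_of_int ((K + 1) div 2) = real_of_int K"
    by (metis of_int_add)
  then show ?case by simp
next
  case (Suc q)
  show ?case unfolding bspline.simps(2)[of "Suc q"] Suc.IH by (simp add: field_simps)
qed

text \<open>Squared mean plus variance \<open>(p + 1) / 16\<close> for the order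
  \<open>p = q + 2\<close>. The base case splits by parity; at order one the variance would still
  depend on the parity of \<open>K\<close>.\<close>

lemma bspline_moment_2:
  "bspline (q + 2) (\<lambda>k. (real_of_int k)\<^sup>2) K =
     (real_of_int K / 2 + (real q + 1) / 4)\<^sup>2 + (real q + 3) / 16"
proof (induction q arbitrary: K)
  case 0
  obtain m where "K = 2 * m \<or> K = 2 * m + 1" by (meson oddE evenE)
  then show ?case
    by (auto simp: numeral_eq_Suc power2_eq_square field_simps)
next
  case (Suc q)
  show ?case unfolding add_Suc bspline.simps(2)[of "q + 2"] Suc.IH
    by (simp add: field_simps power2_eq_square)
qed

text \<open>Cubed mean plus three times variance times mean: the third moment of weights whose third
  central moment is zero.\<close>

lemma bspline_moment_3:
  "bspline (q + 3) (\<lambda>k. (real_of_int k) ^ 3) K =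
     (real_of_int K / 2 + (real q + 2) / 4) ^ 3
     + 3 * ((real q + 4) / 16) * (real_of_int K / 2 + (real q + 2) / 4)"
proof (induction q arbitrary: K)
  case 0
  obtain m where "K = 2 * m \<or> K = 2 * m + 1" by (meson oddE evenE)
  then show ?case
    by (auto simp: numeral_eq_Suc field_simps)
next
  case (Suc q)
  show ?case unfolding add_Suc bspline.simps(2)[of "q + 3"] Suc.IH
    by (simp add: field_simps power3_eq_cube)
qed

text \<open>The mean of the B-spline weights at \<open>K\<close> for \<open>p \<ge> 1\<close>, and
  also the point at which a predictor with shift \<open>(p - 1) / 4\<close> evaluates
  polynomials.\<close>

definition center :: "nat \<Rightarrow> int \<Rightarrow> real" where
  "center p K = real_of_int K / 2 + (real p - 1) / 4"

lemma bspline_centered: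
  assumes "p \<ge> 1"
  shows "bspline p (\<lambda>k. real_of_int k - center p K) K = 0"
proof -
  obtain q where "p = Suc q" using assms by (cases p) auto
  then show ?thesis
    by (simp only: bspline_diff bspline_const bspline_moment_1) (simp add: center_def)
qed

text \<open>For \<open>p = 2\<close> this third central moment does not vanish.\<close>

lemma bspline_centered_cube:
  assumes "p \<ge> 3"
  shows "bspline p (\<lambda>k. (real_of_int k - center p K) ^ 3) K = 0"
proof -
  obtain q where q: "p = q + 3" using assms by (metis le_add_diff_inverse2)
  have q1: "bspline (q + 3) real_of_int K = real_of_int K / 2 + (real q + 2) / 4"
    using bspline_moment_1[of "q + 2" K] by (simp add: eval_nat_numeral)
  have q2: "bspline (q + 3) (\<lambda>k. (real_of_int k)\<^sup>2) K =
     (real_of_int K / 2 + (real q + 2) / 4)\<^sup>2 + (real q + 4) / 16"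
    using bspline_moment_2[of "q + 1" K] by (simp add: eval_nat_numeral algebra_simps)
  define c where "c = center p K"
  have c: "c = real_of_int K / 2 + (real q + 2) / 4" by (simp add: c_def center_def q)
  have "bspline p (\<lambda>k. (real_of_int k - c) ^ 3) K
    = bspline p (\<lambda>k. (real_of_int k) ^ 3 - 3 * c * (real_of_int k)\<^sup>2
        + 3 * c\<^sup>2 * real_of_int k - c ^ 3) K"
    by (rule bspline_cong) (simp add: power2_eq_square power3_eq_cube algebra_simps)
  also have "\<dots> = 0"
    unfolding bspline_diff bspline_add bspline_mult bspline_const q q1 q2 bspline_moment_3
      c[symmetric]
    by (simp add: power2_eq_square power3_eq_cube algebra_simps)
  finally show ?thesis by (simp add: c_def)
qed

section \<open>Linearity, norm bound and centred moments of the predictor\<close>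

lemma subdiv_add: "subdiv a (\<lambda>k. x k + y k) K = subdiv a x K + subdiv a y K"
  by (simp add: subdiv_def scaleR_add_right sum.distrib)

lemma subdiv_linear:
  assumes "linear f"
  shows "subdiv a (\<lambda>k. f (x k)) K = f (subdiv a x K)"
  by (simp add: subdiv_def linear_sum[OF assms] linear_scale[OF assms])

lemma subdiv_mult: "subdiv a (\<lambda>k. c * x k) K = c * subdiv a x K" for c :: real
  by (rule subdiv_linear) (simp add: linear_iff algebra_simps)

lemma subdiv_scaleR: "subdiv a (\<lambda>k. x k *\<^sub>R c) K = subdiv a x K *\<^sub>R c"
  by (rule subdiv_linear) (simp add: linear_iff algebra_simps)

lemma subdiv_cong:
  assumes "\<And>k. a (K - 2 * k) \<noteq> 0 \<Longrightarrow> x k = y k"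
  shows "subdiv a x K = subdiv a y K"
  unfolding subdiv_def using assms by (intro sum.cong) auto

text \<open>The substitution of \<open>K - 2 * k\<close> embeds each row into the whole mask, so the
  sum of all absolute mask entries serves for every \<open>K\<close>.\<close>

lemma subdiv_norm_le:
  assumes fin: "finite {k. a k \<noteq> 0}" and B: "\<And>k. a (K - 2 * k) \<noteq> 0 \<Longrightarrow> norm (x k) \<le> B"
    and "B \<ge> 0"
  shows "norm (subdiv a x K) \<le> (\<Sum>k | a k \<noteq> 0. \<bar>a k\<bar>) * B"
proof -
  have "norm (subdiv a x K) \<le> (\<Sum>k | a (K - 2 * k) \<noteq> 0. \<bar>a (K - 2 * k)\<bar> * B)"
    unfolding subdiv_def
    by (rule sum_norm_le) (auto intro!: mult_left_mono B)
  also have "\<dots> = (\<Sum>k\<in>(\<lambda>k. K - 2 * k) ` {k. a (K - 2 * k) \<noteq> 0}. \<bar>a k\<bar> * B)"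
    by (subst sum.reindex) (auto simp: inj_on_def)
  also have "\<dots> \<le> (\<Sum>k | a k \<noteq> 0. \<bar>a k\<bar> * B)"
    using fin \<open>B \<ge> 0\<close> by (intro sum_mono2) auto
  finally show ?thesis by (simp add: sum_distrib_right)
qed

text \<open>Reproduction is applied to a power of a linear polynomial that vanishes at the
  evaluation point; only the power 0 survives, as \<open>0 ^ 0 = 1\<close>.\<close>

lemma subdiv_centered_power:
  assumes "exact_reproduction a P c" and "n < P"
  shows "subdiv a (\<lambda>k. (real_of_int k - (real_of_int K / 2 + c)) ^ n) K = 0 ^ n"
proof -
  have "degree ([:- (real_of_int K / 2 + c), 1:] ^ n) = n"
    by (simp add: degree_power_eq)
  then have "subdiv a (\<lambda>k. poly ([:- (real_of_int K / 2 + c), 1:] ^ n) (real_of_int k)) K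
      = poly ([:- (real_of_int K / 2 + c), 1:] ^ n) (real_of_int K / 2 + c)"
    using assms unfolding exact_reproduction_def by metis
  then show ?thesis by (simp add: algebra_simps)
qed

section \<open>Discrete Newton expansions with remainder\<close>

lemma fdiff_power_bound:
  fixes f :: "int \<Rightarrow> real"
  assumes f0: "f 0 = 0" and d: "\<And>i. \<bar>fdiff f i\<bar> \<le> B * real_of_int \<bar>i\<bar> ^ m" and B: "B \<ge> 0"
  shows "\<bar>f k\<bar> \<le> B * real_of_int \<bar>k\<bar> ^ Suc m"
proof -
  have "\<bar>f (int n)\<bar> \<le> B * real n ^ Suc m" for n
  proof (induction n)
    case (Suc n)
    have "\<bar>f (int (Suc n))\<bar> \<le> \<bar>f (int n)\<bar> + \<bar>fdiff f (int n)\<bar>"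
      by (simp add: fdiff_def algebra_simps)
    also have "\<dots> \<le> B * real n ^ Suc m + B * real n ^ m" using Suc d[of "int n"] by simp
    also have "\<dots> = B * (real n ^ m * real (Suc n))" by (simp add: algebra_simps)
    also have "\<dots> \<le> B * (real (Suc n) ^ m * real (Suc n))"
      using B by (intro mult_left_mono mult_right_mono power_mono) auto
    finally show ?case by (simp add: algebra_simps)
  qed (simp add: f0)
  \<comment> \<open>\<open>fdiff\<close> is a forward difference, so negative indices need an
    induction of their own.\<close>
  moreover have "\<bar>f (- int n)\<bar> \<le> B * real n ^ Suc m" for n
  proof (induction n)
    case (Suc n)
    have "\<bar>f (- int (Suc n))\<bar> \<le> \<bar>f (- int n)\<bar> + \<bar>fdiff f (- int (Suc n))\<bar>"
      by (simp add: fdiff_def algebra_simps)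
    also have "\<dots> \<le> B * real n ^ Suc m + B * real (Suc n) ^ m"
      using Suc d[of "- int (Suc n)"] by (simp add: add.commute)
    also have "\<dots> = B * (real n ^ m * real n + real (Suc n) ^ m)"
      by (simp add: algebra_simps)
    also have "\<dots> \<le> B * (real (Suc n) ^ m * real n + real (Suc n) ^ m)"
      using B by (intro mult_left_mono add_right_mono mult_right_mono power_mono) auto
    finally show ?case by (simp add: algebra_simps)
  qed (simp add: f0)
  ultimately show ?thesis
    by (cases k rule: int_cases2) (metis abs_of_nat of_int_of_nat_eq,
      metis abs_minus abs_of_nat of_int_of_nat_eq)
qed

lemma newton_1:
  fixes x :: "int \<Rightarrow> real"
  assumes "\<And>i. \<bar>fdiff x i\<bar> \<le> H"
  shows "\<bar>x k - x l\<bar> \<le> H * real_of_int \<bar>k - l\<bar>"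
proof -
  have "0 \<le> H" using assms[of 0] by linarith
  then show ?thesis
    using fdiff_power_bound[of "\<lambda>i. x (l + i) - x l" H 0 "k - l"] assms
    by (simp add: fdiff_def flip: add.assoc)
qed

lemma newton_2:
  fixes x :: "int \<Rightarrow> real"
  assumes "\<And>i. \<bar>fdiff (fdiff x) i\<bar> \<le> H"
  shows "\<bar>x k - x l - real_of_int (k - l) * fdiff x l\<bar> \<le> H * real_of_int \<bar>k - l\<bar> ^ 2"
proof -
  define f where "f i = x (l + i) - x l - real_of_int i * fdiff x l" for i
  have "fdiff f i = fdiff x (l + i) - fdiff x l" for i
    by (simp add: f_def fdiff_def algebra_simps)
  moreover have "\<bar>fdiff x (l + i) - fdiff x l\<bar> \<le> H * real_of_int \<bar>i\<bar>" for i
    using newton_1[of "fdiff x" H "l + i" l] assms by simp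
  moreover have "0 \<le> H" using assms[of 0] by linarith
  ultimately show ?thesis
    using fdiff_power_bound[of f H 1 "k - l"] by (simp add: f_def eval_nat_numeral)
qed

text \<open>Newton's forward formula of degree two. The difference of its remainder is the
  degree-one remainder of \<open>fdiff x\<close>, so \<open>newton_2\<close> is summed once.\<close>

lemma newton_3:
  fixes x :: "int \<Rightarrow> real"
  assumes "\<And>i. \<bar>fdiff (fdiff (fdiff x)) i\<bar> \<le> H"
  shows "\<bar>x k - x l - real_of_int (k - l) * fdiff x l
      - real_of_int (k - l) * (real_of_int (k - l) - 1) / 2 * fdiff (fdiff x) l\<bar>
    \<le> H * real_of_int \<bar>k - l\<bar> ^ 3"
proof -
  define f where "f i = x (l + i) - x l - real_of_int i * fdiff x l
    - real_of_int i * (real_of_int i - 1) / 2 * fdiff (fdiff x) l" for i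
  have "fdiff f i = fdiff x (l + i) - fdiff x l - real_of_int i * fdiff (fdiff x) l" for i
    by (simp add: f_def fdiff_def field_simps)
  moreover have "\<bar>fdiff x (l + i) - fdiff x l - real_of_int i * fdiff (fdiff x) l\<bar>
      \<le> H * real_of_int \<bar>i\<bar> ^ 2" for i
    using newton_2[of "fdiff x" H "l + i" l] assms by simp
  moreover have "0 \<le> H" using assms[of 0] by linarith
  ultimately show ?thesis
    using fdiff_power_bound[of f H 2 "k - l"] by (simp add: f_def eval_nat_numeral)
qed

section \<open>Taylor expansion of unit speed curves\<close>

text \<open>The mean value inequality on the segment from 0 to \<open>x\<close>, where the
  derivative is at most \<open>B * \<bar>x\<bar> ^ n\<close>. Without the factor
  \<open>1 / (n + 1)\<close> the same constant survives iteration.\<close>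

lemma derivative_power_bound:
  fixes f :: "real \<Rightarrow> 'a::real_normed_vector"
  assumes f': "\<And>x. (f has_vector_derivative f' x) (at x)" and "f 0 = 0"
    and B: "\<And>x. norm (f' x) \<le> B * \<bar>x\<bar> ^ n" and "B \<ge> 0"
  shows "norm (f x) \<le> B * \<bar>x\<bar> ^ Suc n"
proof -
  define S where "S = closed_segment 0 x"
  have "onorm (\<lambda>h. h *\<^sub>R f' y) \<le> B * \<bar>x\<bar> ^ n" if "y \<in> S" for y
  proof -
    have "\<bar>y\<bar> \<le> \<bar>x\<bar>" using that by (auto simp: S_def closed_segment_eq_real_ivl split: if_splits)
    then have "B * \<bar>y\<bar> ^ n \<le> B * \<bar>x\<bar> ^ n"
      using \<open>B \<ge> 0\<close> by (intro mult_left_mono power_mono) auto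
    with B[of y] have "norm (f' y) \<le> B * \<bar>x\<bar> ^ n" by linarith
    then show ?thesis
      by (intro onorm_le) (simp add: mult.commute mult_left_mono)
  qed
  then have "norm (f x - f 0) \<le> B * \<bar>x\<bar> ^ n * norm (x - 0)"
    using f' by (intro differentiable_bound[where S = S])
      (auto simp: S_def has_vector_derivative_def intro: has_derivative_at_withinI)
  then show ?thesis using \<open>f 0 = 0\<close> by (simp add: mult_ac)
qed

text \<open>One constant bounds all derivatives that occur. A Lipschitz third derivative suffices
  for a Taylor remainder of order four, and \<open>M \<ge> 1\<close> lets lower powers of
  \<open>M\<close> be absorbed into higher ones.\<close>

locale unit_speed =
  fixes v v1 v2 v3 :: "real \<Rightarrow> complex" and M :: real
  assumes v1: "(v has_vector_derivative v1 t) (at t)"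
    and v2: "(v1 has_vector_derivative v2 t) (at t)"
    and v3: "(v2 has_vector_derivative v3 t) (at t)"
    and v2_le: "norm (v2 t) \<le> M" and v3_le: "norm (v3 t) \<le> M"
    and v3_lipschitz: "norm (v3 (t + u) - v3 t) \<le> M * \<bar>u\<bar>"
    and M_ge: "M \<ge> 1"
    and norm_v1: "norm (v1 t) = 1"
begin

text \<open>Differentiate \<open>v1 t \<bullet> v1 t = 1\<close>.\<close>

lemma v1_inner_v2: "v1 t \<bullet> v2 t = 0"
proof -
  have "((\<lambda>t. v1 t \<bullet> v1 t) has_vector_derivative (v1 t \<bullet> v2 t + v2 t \<bullet> v1 t)) (at t)"
    by (rule bounded_bilinear.has_vector_derivative[OF bounded_bilinear_inner v2 v2])
  moreover have "(\<lambda>t. v1 t \<bullet> v1 t) = (\<lambda>_. 1)"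
    by (simp add: dot_square_norm norm_v1)
  ultimately have "v1 t \<bullet> v2 t + v2 t \<bullet> v1 t = 0"
    using vector_derivative_unique_at[of "\<lambda>_. 1"] has_vector_derivative_const by metis
  then show ?thesis by (simp add: inner_commute)
qed

lemma shifted_derivative:
  assumes "\<And>t. (f has_vector_derivative f' t) (at t)"
  shows "((\<lambda>u. f (t + u)) has_vector_derivative f' (t + u)) (at u within S)"
proof -
  have "((\<lambda>u. t + u) has_vector_derivative 1) (at u)"
    by (auto intro!: derivative_eq_intros)
  from vector_diff_chain_at[OF this assms] show ?thesis
    by (simp add: o_def has_vector_derivative_at_within)
qed

lemma taylor_1: "norm (v (t + u) - v t - u *\<^sub>R v1 t) \<le> M * u\<^sup>2"
proof -
  note D = shifted_derivative[OF v1] shifted_derivative[OF v2]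
  have d1: "((\<lambda>u. v1 (t + u) - v1 t) has_vector_derivative v2 (t + u)) (at u)" for u
    by (auto intro!: derivative_eq_intros D)
  have d0: "((\<lambda>u. v (t + u) - v t - u *\<^sub>R v1 t) has_vector_derivative v1 (t + u) - v1 t) (at u)" for u
    by (auto intro!: derivative_eq_intros D)
  have A: "norm (v1 (t + u) - v1 t) \<le> M * \<bar>u\<bar> ^ 1" for u
    using derivative_power_bound[OF d1, of M 0] v2_le M_ge by simp
  show ?thesis
    using derivative_power_bound[OF d0 _ A] M_ge by (simp add: eval_nat_numeral)
qed

definition remainder :: "real \<Rightarrow> real \<Rightarrow> complex" where
  "remainder t u =
     v (t + u) - v t - u *\<^sub>R v1 t - u\<^sup>2 *\<^sub>R ((1 / 2) *\<^sub>R v2 t) - u ^ 3 *\<^sub>R ((1 / 6) *\<^sub>R v3 t)"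

text \<open>Three applications of \<open>derivative_power_bound\<close>, along \<open>d2\<close>,
  \<open>d1\<close> and \<open>d0\<close>, raise the Lipschitz bound on \<open>v3\<close> from power
  one to power four.\<close>

lemma taylor_3: "norm (remainder t u) \<le> M * u ^ 4"
proof -
  note D = shifted_derivative[OF v1] shifted_derivative[OF v2] shifted_derivative[OF v3]
  have p2: "((\<lambda>u. u\<^sup>2 *\<^sub>R ((1 / 2) *\<^sub>R c)) has_vector_derivative u *\<^sub>R c) (at u)"
    for c :: complex and u :: real
    by (rule bounded_linear.has_vector_derivative[OF bounded_linear_scaleR_left,
          THEN has_vector_derivative_eq_rhs, of "\<lambda>u. u\<^sup>2" "2 * u"])
      (auto intro!: derivative_eq_intros simp flip: has_real_derivative_iff_has_vector_derivative)
  have p3: "((\<lambda>u. u ^ 3 *\<^sub>R ((1 / 6) *\<^sub>R c)) has_vector_derivative u\<^sup>2 *\<^sub>R ((1 / 2) *\<^sub>R c)) (at u)"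
    for c :: complex and u :: real
    by (rule bounded_linear.has_vector_derivative[OF bounded_linear_scaleR_left,
          THEN has_vector_derivative_eq_rhs, of "\<lambda>u. u ^ 3" "3 * u\<^sup>2"])
      (auto intro!: derivative_eq_intros simp flip: has_real_derivative_iff_has_vector_derivative)
  have d2: "((\<lambda>u. v2 (t + u) - v2 t - u *\<^sub>R v3 t) has_vector_derivative
      v3 (t + u) - v3 t) (at u)" for u
    by (auto intro!: derivative_eq_intros D)
  have d1: "((\<lambda>u. v1 (t + u) - v1 t - u *\<^sub>R v2 t - u\<^sup>2 *\<^sub>R ((1 / 2) *\<^sub>R v3 t))
      has_vector_derivative v2 (t + u) - v2 t - u *\<^sub>R v3 t) (at u)" for u
    by (intro has_vector_derivative_diff p2) (auto intro!: derivative_eq_intros D)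
  have d0: "(remainder t has_vector_derivative
      v1 (t + u) - v1 t - u *\<^sub>R v2 t - u\<^sup>2 *\<^sub>R ((1 / 2) *\<^sub>R v3 t)) (at u)" for u
    unfolding remainder_def[abs_def]
    by (intro has_vector_derivative_diff p2 p3) (auto intro!: derivative_eq_intros D)
  have "norm (v3 (t + u) - v3 t) \<le> M * \<bar>u\<bar> ^ 1" for u
    using v3_lipschitz by simp
  from derivative_power_bound[OF d2 _ this]
  have A: "norm (v2 (t + u) - v2 t - u *\<^sub>R v3 t) \<le> M * \<bar>u\<bar> ^ Suc 1" for u
    using M_ge by simp
  from derivative_power_bound[OF d1 _ A]
  have B: "norm (v1 (t + u) - v1 t - u *\<^sub>R v2 t - u\<^sup>2 *\<^sub>R ((1 / 2) *\<^sub>R v3 t))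
      \<le> M * \<bar>u\<bar> ^ Suc (Suc 1)" for u
    using M_ge by simp
  from derivative_power_bound[OF d0 _ B]
  have "norm (remainder t u) \<le> M * \<bar>u\<bar> ^ Suc (Suc (Suc 1))"
    using M_ge by (simp add: remainder_def)
  then show ?thesis by (simp add: eval_nat_numeral)
qed

lemma taylor_expansion:
  "v x = v t + (x - t) *\<^sub>R v1 t + (x - t)\<^sup>2 *\<^sub>R ((1 / 2) *\<^sub>R v2 t)
       + (x - t) ^ 3 *\<^sub>R ((1 / 6) *\<^sub>R v3 t) + remainder t (x - t)"
  by (simp add: remainder_def)

end

section \<open>Periodic functions and uniform bounds on the derivatives\<close>

lemma periodic_int:
  fixes f :: "real \<Rightarrow> 'a"
  assumes "\<And>x. f (x + L) = f x"
  shows "f (x + of_int n * L) = f x"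
proof (induction n rule: int_induct[where k = 0])
  case (step1 i)
  then show ?case using assms[of "x + of_int i * L"] by (simp add: algebra_simps)
next
  case (step2 i)
  then show ?case using assms[of "x + (of_int i - 1) * L"] by (simp add: algebra_simps)
qed auto

lemma continuous_periodic_bounded:
  fixes f :: "real \<Rightarrow> 'a::real_normed_vector"
  assumes per: "\<And>x. f (x + L) = f x" and "L > 0" and cont: "continuous_on UNIV f"
  shows "\<exists>B. \<forall>x. norm (f x) \<le> B"
proof -
  have "compact (f ` {0..L})"
    by (intro compact_continuous_image continuous_on_subset[OF cont]) auto
  then have "bounded (f ` {0..L})" by (rule compact_imp_bounded)
  then obtain B where B: "\<And>x. x \<in> {0..L} \<Longrightarrow> norm (f x) \<le> B"
    unfolding bounded_iff by (metis imageI)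
  have "norm (f x) \<le> B" for x
  proof -
    have "frac (x / L) * L \<in> {0..L}"
      using \<open>L > 0\<close> frac_lt_1[of "x / L"] by (simp add: mult_left_le_one_le less_imp_le)
    moreover have "x = frac (x / L) * L + of_int \<lfloor>x / L\<rfloor> * L"
      using \<open>L > 0\<close> by (simp add: frac_def algebra_simps)
    then have "f x = f (frac (x / L) * L + of_int \<lfloor>x / L\<rfloor> * L)"
      by (rule arg_cong)
    then have "f x = f (frac (x / L) * L)"
      using periodic_int[of f L "frac (x / L) * L" "\<lfloor>x / L\<rfloor>", OF per] by (rule trans)
    ultimately show ?thesis using B by auto
  qed
  then show ?thesis by blast
qed

lemma vector_derivative_periodic:
  fixes f :: "real \<Rightarrow> 'a::real_normed_vector"
  assumes per: "\<And>x. f (x + L) = f x" and diff: "\<And>x. f differentiable at x"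
  shows "vector_derivative f (at (x + L)) = vector_derivative f (at x)"
proof -
  have "((\<lambda>x. x + L) has_vector_derivative 1) (at x)"
    by (auto intro!: derivative_eq_intros)
  moreover have "(f has_vector_derivative vector_derivative f (at (x + L))) (at (x + L))"
    using diff vector_derivative_works by blast
  ultimately have "(f \<circ> (\<lambda>x. x + L) has_vector_derivative
      1 *\<^sub>R vector_derivative f (at (x + L))) (at x)"
    by (rule vector_diff_chain_at)
  then have "(f has_vector_derivative vector_derivative f (at (x + L))) (at x)"
    by (simp add: o_def per)
  then show ?thesis by (simp add: vector_derivative_at)
qed

text \<open>All derivatives inherit the period \<open>L\<close>, and continuous periodic functions
  are bounded; the bound on the fourth derivative becomes the Lipschitz constant of the
  third.\<close>

lemma unit_speed_of_curve:
  assumes curve: "closed_arclength_curve v L" and C4: "Ck 4 v"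
  shows "\<exists>v1 v2 v3 M. unit_speed v v1 v2 v3 M"
proof -
  define v1 where "v1 = (\<lambda>t. vector_derivative v (at t))"
  define v2 where "v2 = (\<lambda>t. vector_derivative v1 (at t))"
  define v3 where "v3 = (\<lambda>t. vector_derivative v2 (at t))"
  define v4 where "v4 = (\<lambda>t. vector_derivative v3 (at t))"
  have diff: "v differentiable at t" "v1 differentiable at t" "v2 differentiable at t"
    "v3 differentiable at t" and cont4: "continuous_on UNIV v4" for t
    using C4 by (auto simp: eval_nat_numeral v1_def v2_def v3_def v4_def)
  have L: "L > 0" and per: "v (t + L) = v t" and speed: "norm (v1 t) = 1" for t
    using curve by (auto simp: closed_arclength_curve_def v1_def)
  have der: "(v has_vector_derivative v1 t) (at t)" "(v1 has_vector_derivative v2 t) (at t)"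
    "(v2 has_vector_derivative v3 t) (at t)" "(v3 has_vector_derivative v4 t) (at t)" for t
    using diff vector_derivative_works unfolding v1_def v2_def v3_def v4_def by blast+
  have per1: "v1 (t + L) = v1 t" for t
    using vector_derivative_periodic[of v L, OF per diff(1)] by (simp add: v1_def)
  have per2: "v2 (t + L) = v2 t" for t
    using vector_derivative_periodic[of v1 L, OF per1 diff(2)] by (simp add: v2_def)
  have per3: "v3 (t + L) = v3 t" for t
    using vector_derivative_periodic[of v2 L, OF per2 diff(3)] by (simp add: v3_def)
  have per4: "v4 (t + L) = v4 t" for t
    using vector_derivative_periodic[of v3 L, OF per3 diff(4)] by (simp add: v4_def)
  have cont: "continuous_on UNIV v2" "continuous_on UNIV v3"
    using diff by (auto intro!: differentiable_imp_continuous_on simp: differentiable_on_def)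
  obtain B2 where B2: "\<And>t. norm (v2 t) \<le> B2"
    using continuous_periodic_bounded[OF per2 L cont(1)] by blast
  obtain B3 where B3: "\<And>t. norm (v3 t) \<le> B3"
    using continuous_periodic_bounded[OF per3 L cont(2)] by blast
  obtain B4 where B4: "\<And>t. norm (v4 t) \<le> B4"
    using continuous_periodic_bounded[OF per4 L cont4] by blast
  define M where "M = max 1 (max B2 (max B3 B4))"
  have "norm (v3 (t + u) - v3 t) \<le> M * \<bar>u\<bar>" for t u
  proof -
    have "norm (v3 (t + u) - v3 t) \<le> M * norm (t + u - t)"
    proof (rule differentiable_bound[where S = UNIV])
      show "(v3 has_derivative (\<lambda>h. h *\<^sub>R v4 x)) (at x within UNIV)" for x
        using der(4) by (simp add: has_vector_derivative_def)
      show "onorm (\<lambda>h. h *\<^sub>R v4 x) \<le> M" for x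
        using B4[of x] by (intro onorm_le) (simp add: M_def mult.commute mult_left_mono le_max_iff_disj)
    qed auto
    then show ?thesis by simp
  qed
  moreover have "norm (v2 t) \<le> M" "norm (v3 t) \<le> M" for t
    using B2[of t] B3[of t] by (auto simp: M_def)
  ultimately have "unit_speed v v1 v2 v3 M"
    using der speed by unfold_locales (auto simp: M_def)
  then show ?thesis by blast
qed

section \<open>The normal direction and a first estimate of the new parameter\<close>

locale normal_step = unit_speed +
  fixes p :: nat and s :: "int \<Rightarrow> real" and K :: int
  assumes p_ge: "p \<ge> 3" and s_mono: "strict_mono s"
begin

text \<open>Expanding at the average itself makes the first moment of \<open>u\<close> vanish, see
  \<open>bspline_u\<close>.\<close>

definition base :: real where "base = bspline p s K"

definition u :: "int \<Rightarrow> real" where "u k = s k - base"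

definition width :: real where "width = s ((K + int p) div 2) - s (K div 2)"

definition secant :: complex where "secant = bspline (p - 2) (fdiff (v \<circ> s)) K"

definition D :: real where "D = bspline (p - 2) (fdiff s) K"

text \<open>The coefficient of half the second derivative in the expansion of \<open>secant\<close>;
  it decides whether \<open>tilt\<close> has order one or two.\<close>

definition E :: real where "E = bspline (p - 2) (fdiff (\<lambda>k. (u k)\<^sup>2)) K"

definition m3 :: real where "m3 = bspline p (\<lambda>k. u k ^ 3) K"

text \<open>The vector \<open>e\<close> of the overview. The secant is divided by its leading
  coefficient \<open>D\<close>, not by its norm, so that it stays linear in the data.\<close>

definition tilt :: complex where "tilt = secant /\<^sub>R D - v1 base"

lemma s_le: "i \<le> k \<Longrightarrow> s i \<le> s k"
  using s_mono by (simp add: strict_mono_less_eq)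

lemma width_pos: "width > 0"
proof -
  have "K div 2 < (K + int p) div 2" using p_ge by linarith
  then show ?thesis using s_mono by (simp add: width_def strict_mono_less)
qed

lemma base_bounds: "base \<in> {s (K div 2)..s ((K + int p) div 2)}"
  unfolding base_def by (rule bspline_in_convex) (auto intro: s_le)

lemma u_le: "k \<in> {K div 2..(K + int p) div 2} \<Longrightarrow> \<bar>u k\<bar> \<le> width"
  using base_bounds s_le[of "K div 2" k] s_le[of k "(K + int p) div 2"]
  by (auto simp: u_def width_def)

lemma u_square_le: "k \<in> {K div 2..(K + int p) div 2} \<Longrightarrow> (u k)\<^sup>2 \<le> width\<^sup>2"
  using power_mono[OF u_le, of k 2] by simp

text \<open>Dividing by \<open>D\<close> in \<open>tilt\<close> must cost only one power of
  \<open>width\<close>; strict monotonicity of \<open>s\<close> alone guarantees this.\<close>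

lemma width_le: "width \<le> 2 ^ p * D"
proof -
  \<comment> \<open>The increments averaged at order \<open>p - 2\<close> telescope over exactly the
    window of order \<open>p\<close>.\<close>
  have eq: "(K + int (p - 2)) div 2 + 1 = (K + int p) div 2" using p_ge by linarith
  have le: "width \<le> 2 ^ (p - 2) * D"
    using bspline_fdiff_ge[of s K "p - 2"] s_mono
    by (simp add: width_def D_def eq strict_mono_mono)
  then have "D > 0" using width_pos by (smt (verit) zero_less_mult_pos zero_less_power)
  then have "2 ^ (p - 2) * D \<le> 2 ^ p * D"
    by (intro mult_right_mono power_increasing) auto
  with le show ?thesis by linarith
qed

lemma D_pos: "D > 0"
  using width_le width_pos by (smt (verit) zero_less_mult_pos zero_less_power)

lemma width_div_D: "width / D \<le> 2 ^ p"
  using width_le D_pos by (simp add: divide_simps)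

lemma window_Suc:
  assumes "k \<in> {K div 2..(K + int (p - 2)) div 2}"
  shows "k \<in> {K div 2..(K + int p) div 2}" "k + 1 \<in> {K div 2..(K + int p) div 2}"
  using assms p_ge by auto

lemma bspline_fdiff_le:
  fixes f :: "int \<Rightarrow> 'a::real_normed_vector"
  assumes "\<And>k. k \<in> {K div 2..(K + int p) div 2} \<Longrightarrow> norm (f k) \<le> B"
  shows "norm (bspline (p - 2) (fdiff f) K) \<le> 2 * B"
proof (rule bspline_norm_le)
  fix k assume "k \<in> {K div 2..(K + int (p - 2)) div 2}"
  note window_Suc[OF this, THEN assms]
  then show "norm (fdiff f k) \<le> 2 * B"
    using norm_triangle_ineq4[of "f (k + 1)" "f k"] unfolding fdiff_def by linarith
qed

lemma remainder_le:
  "k \<in> {K div 2..(K + int p) div 2} \<Longrightarrow> norm (remainder base (u k)) \<le> M * width ^ 4"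
proof -
  assume "k \<in> {K div 2..(K + int p) div 2}"
  then have "u k ^ 4 \<le> width ^ 4"
    using power_mono[OF u_le, of k 4] by simp
  then show ?thesis
    using taylor_3[of base "u k"] M_ge mult_left_mono[of "u k ^ 4" "width ^ 4" M] by linarith
qed

lemma expansion:
  "v (s k) = v base + u k *\<^sub>R v1 base + (u k)\<^sup>2 *\<^sub>R ((1 / 2) *\<^sub>R v2 base)
     + u k ^ 3 *\<^sub>R ((1 / 6) *\<^sub>R v3 base) + remainder base (u k)"
  unfolding u_def by (rule taylor_expansion)

lemma secant_expansion:
  "secant = D *\<^sub>R v1 base + E *\<^sub>R ((1 / 2) *\<^sub>R v2 base)
     + bspline (p - 2) (fdiff (\<lambda>k. u k ^ 3)) K *\<^sub>R ((1 / 6) *\<^sub>R v3 base)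
     + bspline (p - 2) (fdiff (\<lambda>k. remainder base (u k))) K"
proof -
  have "fdiff (v \<circ> s) = (\<lambda>k. fdiff s k *\<^sub>R v1 base
      + fdiff (\<lambda>k. (u k)\<^sup>2) k *\<^sub>R ((1 / 2) *\<^sub>R v2 base)
      + fdiff (\<lambda>k. u k ^ 3) k *\<^sub>R ((1 / 6) *\<^sub>R v3 base) + fdiff (\<lambda>k. remainder base (u k)) k)"
    unfolding fdiff_def o_def expansion scaleR_diff_left
    by (rule ext) (simp add: u_def scaleR_diff_left)
  then show ?thesis
    by (simp only: secant_def D_def E_def bspline_add bspline_scaleR)
qed

text \<open>In the expansion of \<open>secant\<close>, divided by \<open>D\<close>, the quadratic
  term leaves \<open>\<bar>E\<bar> / D\<close>, and \<open>width / D \<le> 2 ^ p\<close> turns the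
  cubic and the remainder term into order two.\<close>

lemma tilt_le:
  assumes "width \<le> 1"
  shows "norm tilt \<le> M * (\<bar>E\<bar> / D) + 3 * M * 2 ^ p * width\<^sup>2"
proof -
  define F where "F = bspline (p - 2) (fdiff (\<lambda>k. u k ^ 3)) K"
  define Q where "Q = bspline (p - 2) (fdiff (\<lambda>k. remainder base (u k))) K"
  have W: "width > 0" by (rule width_pos)
  have F: "\<bar>F\<bar> \<le> 2 * width ^ 3"
    using bspline_fdiff_le[of "\<lambda>k. u k ^ 3" "width ^ 3"] u_le
    by (auto simp: F_def power_abs power_mono)
  have Q: "norm Q \<le> 2 * (M * width ^ 4)"
    using bspline_fdiff_le[of "\<lambda>k. remainder base (u k)" "M * width ^ 4"] remainder_le
    by (auto simp: Q_def)
  define Y where "Y = E *\<^sub>R ((1 / 2) *\<^sub>R v2 base) + F *\<^sub>R ((1 / 6) *\<^sub>R v3 base) + Q"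
  have "secant = D *\<^sub>R v1 base + Y"
    unfolding secant_expansion F_def Q_def Y_def by (simp only: add.assoc)
  then have "tilt = Y /\<^sub>R D"
    using D_pos by (simp add: tilt_def scaleR_add_right)
  then have "norm tilt = norm Y / D"
    using D_pos by (simp add: divide_inverse mult.commute)
  also have "\<dots> \<le> (\<bar>E\<bar> * M + width ^ 3 * M + 2 * (M * width ^ 4)) / D"
  proof (rule divide_right_mono)
    have "norm (E *\<^sub>R ((1 / 2) *\<^sub>R v2 base)) \<le> \<bar>E\<bar> * M"
      using mult_left_mono[of "norm (v2 base) / 2" M "\<bar>E\<bar>"] v2_le[of base] M_ge by simp
    moreover have "norm (F *\<^sub>R ((1 / 6) *\<^sub>R v3 base)) \<le> width ^ 3 * M"
      using mult_mono[OF F, of "norm (v3 base) / 6" "M / 2"] v3_le[of base] M_ge W by simp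
    ultimately show "norm Y
        \<le> \<bar>E\<bar> * M + width ^ 3 * M + 2 * (M * width ^ 4)"
      using Q norm_triangle_mono[OF norm_triangle_mono] unfolding Y_def by blast
  qed (use D_pos in simp)
  also have "\<dots> = M * (\<bar>E\<bar> / D) + (width ^ 2 * M + 2 * M * width ^ 3) * (width / D)"
    by (simp add: add_divide_distrib power2_eq_square power3_eq_cube power4_eq_xxxx algebra_simps)
  also have "\<dots> \<le> M * (\<bar>E\<bar> / D) + (3 * M * width\<^sup>2) * 2 ^ p"
  proof (intro add_left_mono mult_mono width_div_D)
    have "width ^ 3 \<le> width\<^sup>2"
      using W assms by (intro power_decreasing) auto
    then have "M * width ^ 3 \<le> M * width\<^sup>2" using M_ge by (intro mult_left_mono) auto
    then show "width\<^sup>2 * M + 2 * M * width ^ 3 \<le> 3 * M * width\<^sup>2" by (simp add: algebra_simps)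
  qed (use W M_ge D_pos in auto)
  finally show ?thesis by (simp add: mult_ac)
qed

lemma bspline_u: "bspline p u K = 0"
  unfolding u_def[abs_def] bspline_diff bspline_const by (simp add: base_def)

lemma secant_tilt: "secant = D *\<^sub>R (v1 base + tilt)"
  using D_pos by (simp add: tilt_def)

text \<open>The orthogonality relation is expanded at \<open>base\<close>. As \<open>v1 base\<close>
  and \<open>v2 base\<close> are orthogonal, the second moment enters only through
  \<open>tilt\<close>, and what multiplies \<open>s' - base\<close> is close to 1.\<close>

lemma offset_le:
  assumes "width \<le> 1" and tilt: "norm tilt \<le> 1 / 4" and near: "M * \<bar>s' - base\<bar> \<le> 1 / 8"
    and ortho: "(v s' - bspline p (v \<circ> s) K) \<bullet> secant = 0"
  shows "\<bar>s' - base\<bar> \<le> 2 * (M * width\<^sup>2 * norm tilt + M * \<bar>m3\<bar> + 2 * M * width ^ 4)"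
proof -
  define d where "d = s' - base"
  define m2 where "m2 = bspline p (\<lambda>k. (u k)\<^sup>2) K"
  define Q where "Q = bspline p (\<lambda>k. remainder base (u k)) K"
  define T where "T = v s' - v base - d *\<^sub>R v1 base"
  have T: "norm T \<le> M * \<bar>d\<bar> * \<bar>d\<bar>"
    using taylor_1[of base d] by (simp add: T_def d_def power2_eq_square)
  have Q: "norm Q \<le> M * width ^ 4"
    unfolding Q_def by (rule bspline_norm_le) (rule remainder_le)
  have m2: "\<bar>m2\<bar> \<le> width\<^sup>2"
    using bspline_norm_le[of K p "\<lambda>k. (u k)\<^sup>2" "width\<^sup>2"] u_square_le
    by (simp add: m2_def)
  have nv: "norm (v1 base + tilt) \<le> 5 / 4"
    using norm_triangle_ineq[of "v1 base" tilt] tilt by (simp add: norm_v1)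
  have X: "bspline p (v \<circ> s) K = v base + m2 *\<^sub>R ((1 / 2) *\<^sub>R v2 base)
      + m3 *\<^sub>R ((1 / 6) *\<^sub>R v3 base) + Q"
    unfolding o_def expansion bspline_add bspline_scaleR bspline_const
    by (simp add: bspline_u m2_def m3_def Q_def)
  have v11: "v1 base \<bullet> v1 base = 1" by (simp add: dot_square_norm norm_v1)
  have v21: "v2 base \<bullet> v1 base = 0" using v1_inner_v2[of base] by (simp add: inner_commute)
  have "(v s' - bspline p (v \<circ> s) K) \<bullet> (v1 base + tilt) = 0"
    using ortho D_pos by (simp add: secant_tilt)
  moreover have "v s' - bspline p (v \<circ> s) K = d *\<^sub>R v1 base + T
      - (m2 *\<^sub>R ((1 / 2) *\<^sub>R v2 base) + m3 *\<^sub>R ((1 / 6) *\<^sub>R v3 base) + Q)"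
    by (simp add: X T_def)
  ultimately have "d + d * (v1 base \<bullet> tilt) + T \<bullet> (v1 base + tilt) =
      m2 / 2 * (v2 base \<bullet> tilt) + m3 / 6 * (v3 base \<bullet> (v1 base + tilt)) + Q \<bullet> (v1 base + tilt)"
    by (simp add: inner_diff_left inner_add_left inner_add_right v11 v21 algebra_simps)
  moreover have "\<bar>d * (v1 base \<bullet> tilt)\<bar> \<le> \<bar>d\<bar> * (1 / 4)"
    unfolding abs_mult using Cauchy_Schwarz_ineq2[of "v1 base" tilt] tilt
    by (intro mult_left_mono) (auto simp: norm_v1)
  moreover have "\<bar>T \<bullet> (v1 base + tilt)\<bar> \<le> \<bar>d\<bar> * (5 / 32)"
  proof -
    have "\<bar>T \<bullet> (v1 base + tilt)\<bar> \<le> norm T * norm (v1 base + tilt)"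
      by (rule Cauchy_Schwarz_ineq2)
    also have "\<dots> \<le> (M * \<bar>d\<bar> * \<bar>d\<bar>) * (5 / 4)"
      using T nv M_ge by (intro mult_mono) auto
    also have "\<dots> \<le> (1 / 8 * \<bar>d\<bar>) * (5 / 4)"
      using near by (intro mult_right_mono) (auto simp: d_def)
    finally show ?thesis by simp
  qed
  moreover have "\<bar>m2 / 2 * (v2 base \<bullet> tilt)\<bar> \<le> M * width\<^sup>2 * norm tilt"
  proof -
    have "\<bar>v2 base \<bullet> tilt\<bar> \<le> M * norm tilt"
      using Cauchy_Schwarz_ineq2[of "v2 base" tilt]
        mult_right_mono[OF v2_le[of base], of "norm tilt"] by simp
    then have "\<bar>m2 / 2\<bar> * \<bar>v2 base \<bullet> tilt\<bar> \<le> width\<^sup>2 * (M * norm tilt)"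
      using m2 by (intro mult_mono) auto
    then show ?thesis by (simp add: abs_mult mult_ac)
  qed
  moreover have "\<bar>m3 / 6 * (v3 base \<bullet> (v1 base + tilt))\<bar> \<le> M * \<bar>m3\<bar>"
  proof -
    have "\<bar>v3 base \<bullet> (v1 base + tilt)\<bar> \<le> norm (v3 base) * norm (v1 base + tilt)"
      by (rule Cauchy_Schwarz_ineq2)
    also have "\<dots> \<le> M * (5 / 4)" using v3_le nv M_ge by (intro mult_mono) auto
    finally have "\<bar>m3 / 6\<bar> * \<bar>v3 base \<bullet> (v1 base + tilt)\<bar> \<le> \<bar>m3 / 6\<bar> * (M * (5 / 4))"
      by (intro mult_left_mono) auto
    also have "\<dots> = \<bar>m3\<bar> * M * (5 / 24)" by simp
    also have "\<dots> \<le> \<bar>m3\<bar> * M * 1" using M_ge by (intro mult_left_mono) auto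
    finally show ?thesis by (simp add: abs_mult mult_ac)
  qed
  moreover have "\<bar>Q \<bullet> (v1 base + tilt)\<bar> \<le> 2 * M * width ^ 4"
  proof -
    have "\<bar>Q \<bullet> (v1 base + tilt)\<bar> \<le> norm Q * norm (v1 base + tilt)"
      by (rule Cauchy_Schwarz_ineq2)
    also have "\<dots> \<le> (M * width ^ 4) * (5 / 4)" using Q nv M_ge by (intro mult_mono) auto
    also have "\<dots> \<le> (M * width ^ 4) * 2" using M_ge by (intro mult_left_mono) auto
    finally show ?thesis by simp
  qed
  \<comment> \<open>Since 1/4 + 5/32 < 1/2, the two terms containing \<open>d\<close> are absorbed
    at the price of the factor 2.\<close>
  moreover have "\<bar>d\<bar> \<le> 2 * (e1 + e2 + e3)"
    if "d + b + c = x + y + z" "\<bar>b\<bar> \<le> \<bar>d\<bar> * (1 / 4)" "\<bar>c\<bar> \<le> \<bar>d\<bar> * (5 / 32)"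
      "\<bar>x\<bar> \<le> e1" "\<bar>y\<bar> \<le> e2" "\<bar>z\<bar> \<le> e3" for b c x y z e1 e2 e3 :: real
  proof -
    have "\<bar>d\<bar> \<le> \<bar>b\<bar> + \<bar>c\<bar> + (\<bar>x\<bar> + \<bar>y\<bar> + \<bar>z\<bar>)" using that(1) by arith
    with that(2-) show ?thesis by argo
  qed
  ultimately show ?thesis unfolding d_def[symmetric] by blast
qed

lemma width_le_h:
  assumes "\<And>k. fdiff s k \<le> h"
  shows "width \<le> real p * h"
proof -
  have "\<bar>fdiff s k\<bar> \<le> h" for k using assms[of k] s_le[of k "k + 1"] by (simp add: fdiff_def)
  from newton_1[of s h "(K + int p) div 2" "K div 2", OF this]
  have "width \<le> h * real_of_int \<bar>(K + int p) div 2 - K div 2\<bar>" by (simp add: width_def)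
  also have "\<dots> \<le> h * real_of_int (int p)"
  proof (intro mult_left_mono)
    show "0 \<le> h" using assms[of 0] s_le[of 0 1] by (simp add: fdiff_def)
    have "\<bar>(K + int p) div 2 - K div 2\<bar> \<le> int p" using p_ge by linarith
    then show "real_of_int \<bar>(K + int p) div 2 - K div 2\<bar> \<le> real_of_int (int p)"
      by (rule of_int_le_iff[THEN iffD2])
  qed
  finally show ?thesis by (simp add: mult.commute)
qed

text \<open>Too weak for the details, but it presupposes nothing about second differences of \<open>s\<close> and so
  starts the bootstrap.\<close>

lemma offset_cubic:
  assumes h: "\<And>k. fdiff s k \<le> h" and small: "20 * M * 2 ^ p * (real p * h) \<le> 1"
    and near: "M * \<bar>s' - base\<bar> \<le> 1 / 8"
    and ortho: "(v s' - bspline p (v \<circ> s) K) \<bullet> secant = 0"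
  shows "\<bar>s' - base\<bar> \<le> 16 * M\<^sup>2 * 2 ^ p * (real p * h) ^ 3"
proof -
  define P :: real where "P = 2 ^ p"
  have P: "P \<ge> 1" by (simp add: P_def)
  have W: "width > 0" "width \<le> real p * h" using width_pos width_le_h[OF h] by auto
  have MP: "M * P \<ge> 1" using M_ge P mult_mono[of 1 M 1 P] by simp
  \<comment> \<open>The constant 20 makes the bound \<open>5 * (M * P * width)\<close> on the tilt
    at most 1/4, as \<open>offset_le\<close> requires.\<close>
  have MPW: "M * P * width \<le> 1 / 20"
    using small mult_left_mono[OF W(2), of "M * P"] MP by (simp add: P_def)
  have W1: "width \<le> 1" using MPW mult_right_mono[OF MP, of width] W(1) by linarith
  \<comment> \<open>No cancellation is available yet, so \<open>E\<close> has order two and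
    \<open>tilt\<close> only order one.\<close>
  have "\<bar>E\<bar> \<le> 2 * width\<^sup>2"
    using bspline_fdiff_le[of "\<lambda>k. (u k)\<^sup>2" "width\<^sup>2"] u_square_le
    by (simp add: E_def)
  then have "\<bar>E\<bar> / D \<le> 2 * width\<^sup>2 / D" using D_pos by (intro divide_right_mono) auto
  also have "\<dots> = 2 * width * (width / D)" by (simp add: power2_eq_square)
  also have "\<dots> \<le> 2 * width * P"
    unfolding P_def using W by (intro mult_left_mono width_div_D) auto
  finally have ED: "\<bar>E\<bar> / D \<le> 2 * width * P" .
  have "M * P * width\<^sup>2 \<le> M * P * width"
    using W(1) W1 MP by (intro mult_left_mono) (auto simp: power2_eq_square mult_left_le_one_le)
  moreover have "M * (\<bar>E\<bar> / D) \<le> M * (2 * width * P)" using ED M_ge by (intro mult_left_mono) auto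
  ultimately have tilt: "norm tilt \<le> 5 * (M * P * width)"
    using tilt_le[OF W1] by (simp add: P_def mult_ac)
  have m3: "\<bar>m3\<bar> \<le> width ^ 3"
    using bspline_norm_le[of K p "\<lambda>k. u k ^ 3" "width ^ 3"] u_le
    by (simp add: m3_def power_abs power_mono)
  have "\<bar>s' - base\<bar> \<le> 2 * (M * width\<^sup>2 * norm tilt + M * \<bar>m3\<bar> + 2 * M * width ^ 4)"
    using tilt MPW by (intro offset_le W1 near ortho) linarith
  also have "\<dots> \<le> 2 * (M * width\<^sup>2 * (5 * (M * P * width)) + M * (M * P) * width ^ 3
      + 2 * M * (M * P) * width ^ 3)"
  proof -
    have "M * \<bar>m3\<bar> \<le> M * (M * P) * width ^ 3"
      using m3 MP M_ge mult_mono[of 1 "M * P" "\<bar>m3\<bar>" "width ^ 3"]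
      by (simp add: mult.assoc mult_left_mono)
    moreover have "width ^ 4 \<le> (M * P) * width ^ 3"
      using W W1 MP mult_right_mono[of width "M * P" "width ^ 3"]
      by (simp add: eval_nat_numeral)
    then have "2 * M * width ^ 4 \<le> 2 * M * (M * P) * width ^ 3"
      using M_ge by (simp add: mult.assoc mult_left_mono)
    moreover have "M * width\<^sup>2 * norm tilt \<le> M * width\<^sup>2 * (5 * (M * P * width))"
      using tilt M_ge by (intro mult_left_mono) auto
    ultimately show ?thesis by (intro mult_left_mono[of _ _ 2] add_mono) auto
  qed
  also have "\<dots> = 16 * M\<^sup>2 * P * width ^ 3"
    by (simp add: power2_eq_square power3_eq_cube algebra_simps)
  also have "\<dots> \<le> 16 * M\<^sup>2 * P * (real p * h) ^ 3"
    using W P by (intro mult_left_mono power_mono) auto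
  finally show ?thesis by (simp add: P_def)
qed

end

section \<open>The new parameter under control of second differences\<close>

text \<open>\<open>R\<close> is the radius of an index window about \<open>K div 2\<close> that
  holds the B-spline window and, later, also the row of the predictor.\<close>

locale controlled_step = normal_step +
  fixes R :: nat and h H2 :: real
  assumes R_ge: "R \<ge> p" and diff_1: "\<And>k. fdiff s k \<le> h"
    and diff_2: "\<And>k. \<bar>fdiff (fdiff s) k\<bar> \<le> H2"
begin

definition \<alpha> :: real where "\<alpha> = fdiff s (K div 2)"

definition y :: "int \<Rightarrow> real" where "y k = real_of_int k - center p K"

text \<open>The deviation of the nodes from an arithmetic progression with step
  \<open>\<alpha>\<close>, placed so that the progression has average \<open>base\<close>.\<close>

definition \<eta> :: "int \<Rightarrow> real" where "\<eta> k = u k - \<alpha> * y k"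

definition near :: "int \<Rightarrow> bool" where "near k \<longleftrightarrow> \<bar>k - K div 2\<bar> \<le> int R"

lemma H2_nonneg: "0 \<le> H2"
  using diff_2[of 0] by linarith

lemma fdiff_pos: "fdiff s k > 0"
  using s_mono by (simp add: fdiff_def strict_mono_less)

lemma h_pos: "h > 0"
  using diff_1[of 0] fdiff_pos[of 0] by linarith

lemma near_window:
  assumes "k \<in> {K div 2..(K + int p) div 2}"
  shows "near k"
proof -
  have "\<bar>k - K div 2\<bar> \<le> int p" using assms p_ge by auto
  then show ?thesis using R_ge by (simp add: near_def)
qed

lemma near_real: "near k \<Longrightarrow> real_of_int \<bar>k - K div 2\<bar> \<le> real R"
  unfolding near_def by (metis of_int_le_iff of_int_of_nat_eq)

lemma width_le_Rh: "width \<le> real R * h"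
proof -
  have "real p * h \<le> real R * h" using R_ge h_pos by (intro mult_right_mono) auto
  then show ?thesis using width_le_h[OF diff_1] by linarith
qed

lemma y_le:
  assumes "near k"
  shows "\<bar>y k\<bar> \<le> 2 * real R"
proof -
  have "2 * (K div 2) \<le> K \<and> K \<le> 2 * (K div 2) + 1" by linarith
  then have "real_of_int (2 * (K div 2)) \<le> real_of_int K"
    "real_of_int K \<le> real_of_int (2 * (K div 2) + 1)"
    by (simp_all only: of_int_le_iff)
  then have "\<bar>real_of_int (K div 2) - center p K\<bar> \<le> real p"
    using p_ge by (simp add: center_def abs_le_iff field_simps)
  moreover have "\<bar>real_of_int k - real_of_int (K div 2)\<bar> \<le> real R"
    using near_real[OF assms] by simp
  moreover have "real p \<le> real R" using R_ge by simp
  ultimately show ?thesis unfolding y_def by linarith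
qed

lemma bspline_y: "bspline p y K = 0"
  unfolding y_def[abs_def] using bspline_centered p_ge by simp

lemma bspline_y_cube: "bspline p (\<lambda>k. y k ^ 3) K = 0"
  unfolding y_def using bspline_centered_cube p_ge by simp

text \<open>As \<open>y\<close> has average zero, \<open>\<eta>\<close> is the Newton remainder
  \<open>\<rho>\<close> at \<open>K div 2\<close> minus its own B-spline average.\<close>

lemma \<eta>_le:
  assumes "near k"
  shows "\<bar>\<eta> k\<bar> \<le> 2 * (real R)\<^sup>2 * H2"
proof -
  define \<rho> where "\<rho> k = s k - s (K div 2) - real_of_int (k - K div 2) * \<alpha>" for k
  have \<rho>: "\<bar>\<rho> k\<bar> \<le> (real R)\<^sup>2 * H2" if "near k" for k
  proof -
    have "\<bar>\<rho> k\<bar> \<le> H2 * real_of_int \<bar>k - K div 2\<bar> ^ 2"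
      using newton_2[of s H2 k "K div 2"] diff_2 by (simp add: \<rho>_def \<alpha>_def)
    also have "\<dots> \<le> H2 * real R ^ 2"
      using near_real[OF that] H2_nonneg by (intro mult_left_mono power_mono) auto
    finally show ?thesis by (simp add: mult.commute)
  qed
  have s: "s k = \<rho> k + \<alpha> * y k + (s (K div 2) + \<alpha> * (center p K - real_of_int (K div 2)))" for k
    by (simp add: \<rho>_def y_def algebra_simps)
  have "base = bspline p \<rho> K + (s (K div 2) + \<alpha> * (center p K - real_of_int (K div 2)))"
    unfolding base_def
    by (subst s[abs_def]) (simp add: bspline_add bspline_mult bspline_const bspline_y)
  then have "\<eta> k = \<rho> k - bspline p \<rho> K"
    using s[of k] by (simp add: \<eta>_def u_def)
  moreover have "\<bar>bspline p \<rho> K\<bar> \<le> (real R)\<^sup>2 * H2"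
    using bspline_norm_le[of K p \<rho> "(real R)\<^sup>2 * H2"] \<rho> near_window by simp
  ultimately show ?thesis using \<rho>[OF assms] by linarith
qed

lemma u_near:
  assumes "near k"
  shows "\<bar>u k\<bar> \<le> 2 * real R * h"
proof -
  have "\<bar>fdiff s i\<bar> \<le> h" for i using diff_1[of i] fdiff_pos[of i] by linarith
  from newton_1[of s h k "K div 2", OF this]
  have "\<bar>s k - s (K div 2)\<bar> \<le> h * real_of_int \<bar>k - K div 2\<bar>" .
  also have "\<dots> \<le> h * real R" using near_real[OF assms] h_pos by (intro mult_left_mono) auto
  finally have "\<bar>s k - s (K div 2)\<bar> \<le> real R * h" by (simp add: mult.commute)
  then show ?thesis
    using base_bounds width_le_Rh by (auto simp: u_def width_def)
qed

lemma fdiff_le_width: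
  assumes "k \<in> {K div 2..(K + int (p - 2)) div 2}"
  shows "fdiff s k \<le> width"
  using window_Suc[OF assms] s_le[of "K div 2" k] s_le[of "k + 1" "(K + int p) div 2"]
  by (simp add: fdiff_def width_def)

lemma \<alpha>_bounds: "0 < \<alpha>" "\<alpha> \<le> h" "\<alpha> \<le> width"
  using fdiff_pos[of "K div 2"] diff_1[of "K div 2"] fdiff_le_width[of "K div 2"] p_ge
  by (auto simp: \<alpha>_def)

text \<open>The part of exact order two in the differences of \<open>u\<close> squared averages to
  zero, and every term left in \<open>f\<close> carries \<open>H2\<close>. A factor
  \<open>width\<close> is kept because the result is divided by \<open>D\<close> later.\<close>

lemma E_le: "\<bar>E\<bar> \<le> 8 * (real R)\<^sup>2 * width * H2"
proof -
  define f where "f k = (fdiff s k - \<alpha>) * (\<alpha> * (y k + y (k + 1))) + fdiff s k * (\<eta> k + \<eta> (k + 1))"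
    for k
  have u: "u k = \<alpha> * y k + \<eta> k" for k by (simp add: \<eta>_def)
  have "fdiff (\<lambda>k. (u k)\<^sup>2) k = fdiff s k * (u k + u (k + 1))" for k
    by (simp add: fdiff_def u_def power2_eq_square algebra_simps)
  also have "\<dots>k = \<alpha>\<^sup>2 * (y k + y (k + 1)) + f k" for k
    unfolding u[of k] u[of "k + 1"] f_def by (simp add: power2_eq_square algebra_simps)
  finally have eq: "fdiff (\<lambda>k. (u k)\<^sup>2) = (\<lambda>k. \<alpha>\<^sup>2 * (y k + y (k + 1)) + f k)" by (rule ext)
  \<comment> \<open>\<open>center p K\<close> exceeds \<open>center (p - 2) K\<close> by 1/2, just
    as the midpoint of \<open>k\<close> and \<open>k + 1\<close> exceeds \<open>k\<close>. The
    cancellation that follows needs \<open>p - 2 \<ge> 1\<close>.\<close>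
  have "(\<lambda>k. y k + y (k + 1)) = (\<lambda>k. 2 * (real_of_int k - center (p - 2) K))"
    using p_ge by (auto simp: y_def center_def of_nat_diff field_simps)
  then have "bspline (p - 2) (\<lambda>k. y k + y (k + 1)) K = 0"
    using p_ge by (simp only: bspline_mult) (simp add: bspline_centered)
  then have "E = bspline (p - 2) f K"
    unfolding E_def eq bspline_add bspline_mult by simp
  moreover have "norm (bspline (p - 2) f K) \<le> 8 * (real R)\<^sup>2 * width * H2"
  proof (rule bspline_norm_le)
    fix k assume k: "k \<in> {K div 2..(K + int (p - 2)) div 2}"
    note n = window_Suc[OF k, THEN near_window]
    have "\<bar>fdiff s k - \<alpha>\<bar> \<le> H2 * real_of_int \<bar>k - K div 2\<bar>"
      unfolding \<alpha>_def by (rule newton_1) (rule diff_2)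
    also have "\<dots> \<le> H2 * real R"
      using near_real[OF n(1)] H2_nonneg by (intro mult_left_mono) auto
    finally have "\<bar>fdiff s k - \<alpha>\<bar> * (\<alpha> * \<bar>y k + y (k + 1)\<bar>) \<le> (H2 * real R) * (width * (4 * real R))"
      using \<alpha>_bounds y_le[OF n(1)] y_le[OF n(2)] H2_nonneg
      by (intro mult_mono) auto
    moreover have "\<bar>fdiff s k\<bar> * \<bar>\<eta> k + \<eta> (k + 1)\<bar> \<le> width * (4 * (real R)\<^sup>2 * H2)"
      using \<eta>_le[OF n(1)] \<eta>_le[OF n(2)] fdiff_le_width[OF k] fdiff_pos[of k]
      by (intro mult_mono) auto
    ultimately have "\<bar>f k\<bar> \<le> (H2 * real R) * (width * (4 * real R)) + width * (4 * (real R)\<^sup>2 * H2)"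
      unfolding f_def using \<alpha>_bounds(1)
      by (intro order_trans[OF abs_triangle_ineq] add_mono) (auto simp: abs_mult)
    then show "norm (f k) \<le> 8 * (real R)\<^sup>2 * width * H2"
      by (simp add: power2_eq_square algebra_simps)
  qed
  ultimately show ?thesis by simp
qed

text \<open>Factor the difference of cubes: \<open>\<eta> k\<close> times a quadratic expression in
  two quantities of size at most \<open>2 * real R * h\<close>.\<close>

lemma cube_le:
  assumes "near k"
  shows "\<bar>u k ^ 3 - \<alpha> ^ 3 * y k ^ 3\<bar> \<le> 24 * real R ^ 4 * h\<^sup>2 * H2"
proof -
  define b where "b = 2 * real R * h"
  have u: "\<bar>u k\<bar> \<le> b" using u_near[OF assms] by (simp add: b_def)
  have ay: "\<bar>\<alpha> * y k\<bar> \<le> b"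
    using mult_mono[of \<alpha> h "\<bar>y k\<bar>" "2 * real R"] \<alpha>_bounds y_le[OF assms] h_pos
    by (simp add: b_def abs_mult mult_ac)
  have sq: "\<bar>x * z\<bar> \<le> b\<^sup>2" if "\<bar>x\<bar> \<le> b" "\<bar>z\<bar> \<le> b" for x z
    using mult_mono[OF that] that by (simp add: abs_mult power2_eq_square)
  have "\<bar>u k * u k + u k * (\<alpha> * y k) + (\<alpha> * y k) * (\<alpha> * y k)\<bar> \<le> 3 * b\<^sup>2"
    using sq[OF u u] sq[OF u ay] sq[OF ay ay] by linarith
  from mult_mono[OF \<eta>_le[OF assms] this]
  have "\<bar>\<eta> k * (u k * u k + u k * (\<alpha> * y k) + (\<alpha> * y k) * (\<alpha> * y k))\<bar>
      \<le> (2 * (real R)\<^sup>2 * H2) * (3 * b\<^sup>2)"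
    using H2_nonneg by (simp add: abs_mult)
  then show ?thesis
    by (simp add: \<eta>_def b_def eval_nat_numeral algebra_simps)
qed

text \<open>The vanishing third central moment of the B-spline weights removes
  \<open>\<alpha> ^ 3 * y k ^ 3\<close>.\<close>

lemma m3_le: "\<bar>m3\<bar> \<le> 24 * real R ^ 4 * h\<^sup>2 * H2"
proof -
  have "m3 = bspline p (\<lambda>k. (u k ^ 3 - \<alpha> ^ 3 * y k ^ 3) + \<alpha> ^ 3 * y k ^ 3) K"
    by (simp add: m3_def)
  also have "\<dots> = bspline p (\<lambda>k. u k ^ 3 - \<alpha> ^ 3 * y k ^ 3) K"
    unfolding bspline_add bspline_mult bspline_y_cube by simp
  finally show ?thesis
    using bspline_norm_le[of K p "\<lambda>k. u k ^ 3 - \<alpha> ^ 3 * y k ^ 3"] cube_le near_window by simp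
qed

end

text \<open>The regime in which second differences have order two in the mesh width. The constant 44
  is four times the 11 in \<open>Ctilt\<close>, so that the tilt is at most 1/4.\<close>

locale smooth_step = controlled_step +
  fixes B :: real
  assumes B_ge: "B \<ge> 1" and H2_le: "H2 = B * h\<^sup>2"
    and small: "44 * M * 2 ^ p * (real R)\<^sup>2 * B * h \<le> 1" and h_le: "h \<le> 1"
begin

text \<open>Here 11 = 8 + 3, with 8 from \<open>E_le\<close> and 3 from
  \<open>tilt_le\<close>.\<close>

definition Ctilt :: real where "Ctilt = 11 * M * 2 ^ p * (real R)\<^sup>2 * B"

text \<open>Here 74 = 2 * (11 + 24 + 2), one summand for each term of
  \<open>offset_le\<close>.\<close>

definition Coffset :: real where "Coffset = 74 * M\<^sup>2 * 2 ^ p * real R ^ 4 * B"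

lemma R_pos: "real R \<ge> 1"
  using R_ge p_ge by simp

lemma const_ge: "M * 2 ^ p \<ge> 1" "M * 2 ^ p * B \<ge> 1" "real R ^ n \<ge> 1"
proof -
  have "(2::real) ^ p \<ge> 1" by simp
  then show "M * 2 ^ p \<ge> 1" using M_ge mult_mono[of 1 M 1 "2 ^ p"] by simp
  then show "M * 2 ^ p * B \<ge> 1" using B_ge mult_mono[of 1 "M * 2 ^ p" 1 B] by simp
  show "real R ^ n \<ge> 1" using R_pos by (rule one_le_power)
qed

lemma width_le_1: "width \<le> 1"
proof -
  have "1 * real R \<le> (M * 2 ^ p * B) * (real R)\<^sup>2"
    using R_pos const_ge by (intro mult_mono) (auto simp: power2_eq_square)
  then have "real R * h \<le> (M * 2 ^ p * B) * (real R)\<^sup>2 * h"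
    using h_pos by (intro mult_right_mono) auto
  also have "\<dots> \<le> 1" using small h_pos M_ge B_ge by (simp add: mult_ac)
  finally show ?thesis using width_le_Rh by linarith
qed

lemma norm_tilt: "norm tilt \<le> Ctilt * h\<^sup>2"
proof -
  have "\<bar>E\<bar> / D \<le> (8 * (real R)\<^sup>2 * width * H2) / D"
    using E_le D_pos by (intro divide_right_mono) auto
  also have "\<dots> = 8 * (real R)\<^sup>2 * H2 * (width / D)" by simp
  also have "\<dots> \<le> 8 * (real R)\<^sup>2 * H2 * 2 ^ p"
    using H2_nonneg width_div_D by (intro mult_left_mono) auto
  finally have "M * (\<bar>E\<bar> / D) \<le> M * (8 * (real R)\<^sup>2 * H2 * 2 ^ p)"
    using M_ge by (intro mult_left_mono) auto
  moreover have "3 * M * 2 ^ p * width\<^sup>2 \<le> 3 * M * 2 ^ p * (real R * h)\<^sup>2"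
    using M_ge width_pos width_le_Rh by (intro mult_left_mono power_mono) auto
  moreover have "3 * M * 2 ^ p * (real R * h)\<^sup>2 * 1 \<le> 3 * M * 2 ^ p * (real R * h)\<^sup>2 * B"
    using M_ge B_ge by (intro mult_left_mono) auto
  ultimately have "norm tilt \<le> M * (8 * (real R)\<^sup>2 * H2 * 2 ^ p) + 3 * M * 2 ^ p * (real R * h)\<^sup>2 * B"
    using tilt_le[OF width_le_1] by linarith
  then show ?thesis
    by (simp add: Ctilt_def H2_le power2_eq_square algebra_simps)
qed

lemma Ctilt_nonneg: "Ctilt \<ge> 0"
  using M_ge B_ge by (simp add: Ctilt_def)

lemma norm_tilt_le: "norm tilt \<le> 1 / 4"
proof -
  have "Ctilt * h\<^sup>2 \<le> Ctilt * h"
    using h_pos h_le Ctilt_nonneg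
    by (intro mult_left_mono) (auto simp: power2_eq_square mult_left_le_one_le)
  also have "\<dots> \<le> 1 / 4" using small by (simp add: Ctilt_def)
  finally show ?thesis using norm_tilt by linarith
qed

text \<open>All three terms of \<open>offset_le\<close> now have order four: \<open>tilt\<close> has
  order two, \<open>m3\<close> is of size \<open>h\<^sup>2 * H2\<close>, and the remainder is a
  fourth power.\<close>

lemma offset_quartic:
  assumes near: "M * \<bar>s' - base\<bar> \<le> 1 / 8"
    and ortho: "(v s' - bspline p (v \<circ> s) K) \<bullet> secant = 0"
  shows "\<bar>s' - base\<bar> \<le> Coffset * h ^ 4"
proof -
  have "\<bar>s' - base\<bar> \<le> 2 * (M * width\<^sup>2 * norm tilt + M * \<bar>m3\<bar> + 2 * M * width ^ 4)"
    by (rule offset_le[OF width_le_1 norm_tilt_le near ortho])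
  also have "\<dots> \<le> 2 * ((11 * M\<^sup>2 * 2 ^ p * real R ^ 4 * B) * h ^ 4
      + (24 * M\<^sup>2 * 2 ^ p * real R ^ 4 * B) * h ^ 4 + (2 * M\<^sup>2 * 2 ^ p * real R ^ 4 * B) * h ^ 4)"
  proof (intro mult_left_mono[of _ _ 2] add_mono)
    have "M * width\<^sup>2 * norm tilt \<le> M * (real R * h)\<^sup>2 * (Ctilt * h\<^sup>2)"
      using norm_tilt width_pos width_le_Rh M_ge by (intro mult_mono power_mono) auto
    then show "M * width\<^sup>2 * norm tilt \<le> (11 * M\<^sup>2 * 2 ^ p * real R ^ 4 * B) * h ^ 4"
      by (simp add: Ctilt_def eval_nat_numeral algebra_simps)
    have "M * \<bar>m3\<bar> \<le> M * (24 * real R ^ 4 * h\<^sup>2 * H2)"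
      using m3_le M_ge by (intro mult_left_mono) auto
    also have "\<dots> = 24 * M * real R ^ 4 * B * h ^ 4 * 1"
      by (simp add: H2_le eval_nat_numeral algebra_simps)
    also have "\<dots> \<le> 24 * M * real R ^ 4 * B * h ^ 4 * (M * 2 ^ p)"
      using const_ge M_ge B_ge by (intro mult_left_mono) auto
    finally show "M * \<bar>m3\<bar> \<le> (24 * M\<^sup>2 * 2 ^ p * real R ^ 4 * B) * h ^ 4"
      by (simp add: power2_eq_square mult_ac)
    have "2 * M * width ^ 4 \<le> 2 * M * (real R * h) ^ 4 * 1"
      using width_pos width_le_Rh M_ge by (simp add: power_mono)
    also have "\<dots> \<le> 2 * M * (real R * h) ^ 4 * (M * 2 ^ p * B)"
      using const_ge M_ge B_ge by (intro mult_left_mono) auto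
    finally show "2 * M * width ^ 4 \<le> (2 * M\<^sup>2 * 2 ^ p * real R ^ 4 * B) * h ^ 4"
      by (simp add: power2_eq_square power_mult_distrib mult_ac)
  qed simp
  also have "\<dots> = Coffset * h ^ 4"
    by (simp add: Coffset_def algebra_simps)
  finally show ?thesis .
qed

end

section \<open>The detail under control of third differences\<close>

locale detail_step = smooth_step +
  fixes a :: "int \<Rightarrow> real" and Pe :: nat and \<omega> :: complex
  assumes fin: "finite {k. a k \<noteq> 0}" and support: "\<And>k. a (K - 2 * k) \<noteq> 0 \<Longrightarrow> near k"
    and reproduction: "exact_reproduction a Pe ((real p - 1) / 4)" and Pe_ge: "Pe \<ge> 4"
    and diff_3: "\<And>k. \<bar>fdiff (fdiff (fdiff s)) k\<bar> \<le> B * h ^ 3"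
    and \<omega>: "\<omega> \<in> {\<i>, -\<i>}"
begin

definition A :: real where "A = (\<Sum>k | a k \<noteq> 0. \<bar>a k\<bar>)"

definition normal :: complex where "normal = unit_normal \<omega> p (v \<circ> s) K"

lemma A_nonneg: "A \<ge> 0"
  by (simp add: A_def sum_nonneg)

lemma T_le:
  assumes "\<And>k. near k \<Longrightarrow> norm (x k) \<le> C" and "C \<ge> 0"
  shows "norm (subdiv a x K) \<le> A * C"
  unfolding A_def using fin by (rule subdiv_norm_le) (use assms support in auto)

lemma T_y_power: "n < 4 \<Longrightarrow> subdiv a (\<lambda>k. y k ^ n) K = 0 ^ n"
  using subdiv_centered_power[OF reproduction, of n K] Pe_ge by (simp add: y_def center_def)

text \<open>Linear reproduction kills \<open>\<alpha> * y\<close>. Only order two is left, which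
  suffices because this tangential term is multiplied by a factor of the size of \<open>tilt\<close>
  in the detail.\<close>

lemma T_u: "\<bar>subdiv a u K\<bar> \<le> A * (2 * (real R)\<^sup>2 * H2)"
proof -
  have "subdiv a u K = subdiv a (\<lambda>k. \<alpha> * y k + \<eta> k) K"
    by (rule subdiv_cong) (simp add: \<eta>_def)
  also have "\<dots> = subdiv a \<eta> K"
    using T_y_power[of 1] by (simp add: subdiv_add subdiv_mult)
  finally show ?thesis using T_le[of \<eta>] \<eta>_le H2_nonneg by simp
qed

text \<open>This is where cubic reproduction enters: it annihilates the quadratic part of \<open>\<eta>\<close>,
  multiplied by \<open>y\<close>.\<close>

lemma T_y_\<eta>: "\<bar>subdiv a (\<lambda>k. y k * \<eta> k) K\<bar> \<le> A * (2 * real R ^ 4 * (B * h ^ 3))"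
proof -
  define \<beta> where "\<beta> = fdiff (fdiff s) (K div 2)"
  define \<theta> where "\<theta> = center p K - real_of_int (K div 2)"
  define r where "r k = s k - s (K div 2) - real_of_int (k - K div 2) * \<alpha>
    - real_of_int (k - K div 2) * (real_of_int (k - K div 2) - 1) / 2 * \<beta>" for k
  \<comment> \<open>\<open>c0\<close>, \<open>c1\<close> and \<open>\<beta> / 2\<close> are the
    coefficients of the quadratic Newton polynomial in powers of \<open>y\<close>, after
    \<open>base\<close> and \<open>\<alpha> * y\<close> are subtracted.\<close>
  define c0 where "c0 = s (K div 2) + \<alpha> * \<theta> - base + \<beta> * \<theta> * (\<theta> - 1) / 2"
  define c1 where "c1 = \<beta> * (2 * \<theta> - 1) / 2"
  have B: "B * h ^ 3 \<ge> 0" using B_ge h_pos by simp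
  have r: "\<bar>y k * r k\<bar> \<le> 2 * real R ^ 4 * (B * h ^ 3)" if k: "near k" for k
  proof -
    have "\<bar>r k\<bar> \<le> (B * h ^ 3) * real_of_int \<bar>k - K div 2\<bar> ^ 3"
      using newton_3[of s "B * h ^ 3" k "K div 2"] diff_3 by (simp add: r_def \<alpha>_def \<beta>_def)
    also have "\<dots> \<le> (B * h ^ 3) * real R ^ 3"
      using near_real[OF k] B by (intro mult_left_mono power_mono) auto
    finally have "\<bar>y k\<bar> * \<bar>r k\<bar> \<le> (2 * real R) * ((B * h ^ 3) * real R ^ 3)"
      using y_le[OF k] by (intro mult_mono) auto
    then show ?thesis by (simp add: abs_mult eval_nat_numeral mult_ac)
  qed
  have "\<eta> k = r k + c0 + c1 * y k + \<beta> / 2 * (y k)\<^sup>2" for k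
    by (simp add: \<eta>_def u_def r_def y_def \<theta>_def c0_def c1_def field_simps power2_eq_square)
  then have "(\<lambda>k. y k * \<eta> k)
      = (\<lambda>k. y k * r k + c0 * y k ^ 1 + c1 * y k ^ 2 + \<beta> / 2 * y k ^ 3)"
    by (simp add: power2_eq_square power3_eq_cube algebra_simps)
  then have "subdiv a (\<lambda>k. y k * \<eta> k) K = subdiv a (\<lambda>k. y k * r k) K"
    by (simp only: subdiv_add subdiv_mult T_y_power) (simp add: T_y_power)
  then show ?thesis using T_le[of "\<lambda>k. y k * r k"] r B by simp
qed

text \<open>In the square of \<open>\<alpha> * y + \<eta>\<close> the first term is killed by
  reproduction, the mixed one is \<open>\<alpha>\<close> times a term of order three, and the last
  has order four.\<close>

lemma T_u_square: "\<bar>subdiv a (\<lambda>k. (u k)\<^sup>2) K\<bar> \<le> A * (8 * real R ^ 4 * B\<^sup>2) * h ^ 4"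
proof -
  have "(\<lambda>k. (u k)\<^sup>2) = (\<lambda>k. \<alpha>\<^sup>2 * y k ^ 2 + (2 * \<alpha>) * (y k * \<eta> k) + \<eta> k * \<eta> k)"
    by (simp add: \<eta>_def power2_eq_square algebra_simps)
  then have eq: "subdiv a (\<lambda>k. (u k)\<^sup>2) K
      = (2 * \<alpha>) * subdiv a (\<lambda>k. y k * \<eta> k) K + subdiv a (\<lambda>k. \<eta> k * \<eta> k) K"
    by (simp only: subdiv_add subdiv_mult T_y_power) (simp add: T_y_power)
  have f1: "(2 * \<alpha>) * \<bar>subdiv a (\<lambda>k. y k * \<eta> k) K\<bar>
      \<le> (2 * h) * (A * (2 * real R ^ 4 * (B * h ^ 3)))"
    using T_y_\<eta> \<alpha>_bounds by (intro mult_mono) auto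
  have f2: "(2 * h) * (A * (2 * real R ^ 4 * (B * h ^ 3))) \<le> A * (4 * real R ^ 4 * B\<^sup>2) * h ^ 4"
  proof -
    have "(4 * A * real R ^ 4 * h ^ 4) * B \<le> (4 * A * real R ^ 4 * h ^ 4) * B\<^sup>2"
      using B_ge A_nonneg by (intro mult_left_mono) (auto simp: power2_eq_square)
    then show ?thesis by (simp add: eval_nat_numeral mult_ac)
  qed
  have f3: "\<bar>subdiv a (\<lambda>k. \<eta> k * \<eta> k) K\<bar>
      \<le> A * ((2 * (real R)\<^sup>2 * H2) * (2 * (real R)\<^sup>2 * H2))"
  proof -
    have "\<bar>\<eta> k\<bar> * \<bar>\<eta> k\<bar> \<le> (2 * (real R)\<^sup>2 * H2) * (2 * (real R)\<^sup>2 * H2)" if "near k" for k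
      using \<eta>_le[OF that] H2_nonneg by (intro mult_mono) auto
    then have "norm (subdiv a (\<lambda>k. \<eta> k * \<eta> k) K)
        \<le> A * ((2 * (real R)\<^sup>2 * H2) * (2 * (real R)\<^sup>2 * H2))"
      using H2_nonneg by (intro T_le) (auto simp: abs_mult)
    then show ?thesis by simp
  qed
  have f4: "A * ((2 * (real R)\<^sup>2 * H2) * (2 * (real R)\<^sup>2 * H2))
      = A * (4 * real R ^ 4 * B\<^sup>2) * h ^ 4"
    by (simp add: H2_le eval_nat_numeral mult_ac)
  have "\<bar>subdiv a (\<lambda>k. (u k)\<^sup>2) K\<bar>
      \<le> (2 * \<alpha>) * \<bar>subdiv a (\<lambda>k. y k * \<eta> k) K\<bar> + \<bar>subdiv a (\<lambda>k. \<eta> k * \<eta> k) K\<bar>"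
    unfolding eq using \<alpha>_bounds(1) by (intro order_trans[OF abs_triangle_ineq]) (simp add: abs_mult)
  also have "\<dots> \<le> A * (4 * real R ^ 4 * B\<^sup>2) * h ^ 4 + A * (4 * real R ^ 4 * B\<^sup>2) * h ^ 4"
    by (rule add_mono[OF order_trans[OF f1 f2] f3[unfolded f4]])
  also have "\<dots> = A * (8 * real R ^ 4 * B\<^sup>2) * h ^ 4" by simp
  finally show ?thesis .
qed

text \<open>Cubic reproduction removes \<open>\<alpha> ^ 3 * y k ^ 3\<close>; \<open>cube_le\<close>
  bounds the rest.\<close>

lemma T_u_cube: "\<bar>subdiv a (\<lambda>k. u k ^ 3) K\<bar> \<le> A * (24 * real R ^ 4 * h\<^sup>2 * H2)"
proof -
  have "subdiv a (\<lambda>k. u k ^ 3) K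
      = subdiv a (\<lambda>k. \<alpha> ^ 3 * y k ^ 3 + (u k ^ 3 - \<alpha> ^ 3 * y k ^ 3)) K"
    by simp
  also have "\<dots> = subdiv a (\<lambda>k. u k ^ 3 - \<alpha> ^ 3 * y k ^ 3) K"
    by (simp only: subdiv_add subdiv_mult T_y_power) (simp add: T_y_power)
  finally show ?thesis
    using T_le[of "\<lambda>k. u k ^ 3 - \<alpha> ^ 3 * y k ^ 3"] cube_le H2_nonneg by simp
qed

lemma T_remainder: "norm (subdiv a (\<lambda>k. remainder base (u k)) K) \<le> A * (16 * M * real R ^ 4) * h ^ 4"
proof -
  have "norm (remainder base (u k)) \<le> M * (2 * real R * h) ^ 4" if "near k" for k
  proof -
    have "u k ^ 4 \<le> (2 * real R * h) ^ 4" using power_mono[OF u_near[OF that], of 4] by simp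
    then have "M * u k ^ 4 \<le> M * (2 * real R * h) ^ 4" using M_ge by (intro mult_left_mono) auto
    then show ?thesis using taylor_3[of base "u k"] by linarith
  qed
  then show ?thesis
    using T_le[of "\<lambda>k. remainder base (u k)" "M * (2 * real R * h) ^ 4"] M_ge
    by (simp add: power_mult_distrib mult_ac)
qed

lemma T_points:
  "subdiv a (v \<circ> s) K - v base = subdiv a u K *\<^sub>R v1 base
     + subdiv a (\<lambda>k. (u k)\<^sup>2) K *\<^sub>R ((1 / 2) *\<^sub>R v2 base)
     + subdiv a (\<lambda>k. u k ^ 3) K *\<^sub>R ((1 / 6) *\<^sub>R v3 base)
     + subdiv a (\<lambda>k. remainder base (u k)) K"
proof -
  \<comment> \<open>The factor \<open>y k ^ 0\<close> brings the constant term under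
    \<open>T_y_power\<close>.\<close>
  have "(v \<circ> s) = (\<lambda>k. y k ^ 0 *\<^sub>R v base + u k *\<^sub>R v1 base + (u k)\<^sup>2 *\<^sub>R ((1 / 2) *\<^sub>R v2 base)
     + u k ^ 3 *\<^sub>R ((1 / 6) *\<^sub>R v3 base) + remainder base (u k))"
    unfolding o_def expansion by simp
  then have "subdiv a (v \<circ> s) K = subdiv a (\<lambda>k. y k ^ 0) K *\<^sub>R v base + subdiv a u K *\<^sub>R v1 base
     + subdiv a (\<lambda>k. (u k)\<^sup>2) K *\<^sub>R ((1 / 2) *\<^sub>R v2 base)
     + subdiv a (\<lambda>k. u k ^ 3) K *\<^sub>R ((1 / 6) *\<^sub>R v3 base)
     + subdiv a (\<lambda>k. remainder base (u k)) K"
    by (simp only: subdiv_add subdiv_scaleR)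
  then show ?thesis using T_y_power[of 0] by simp
qed

lemma norm_v1_tilt: "norm (v1 base + tilt) \<noteq> 0"
proof
  assume "norm (v1 base + tilt) = 0"
  then have "v1 base = - tilt" by (simp add: eq_neg_iff_add_eq_0)
  then show False using norm_v1[of base] norm_tilt_le by simp
qed

lemma secant_nonzero: "secant \<noteq> 0"
  using norm_v1_tilt D_pos by (simp add: secant_tilt)

lemma norm_normal: "norm normal = 1"
  using secant_nonzero \<omega> by (auto simp: normal_def unit_normal_def norm_mult simp flip: secant_def)

lemma normal_secant: "normal \<bullet> secant = 0"
  using \<omega> by (auto simp: normal_def unit_normal_def inner_complex_def algebra_simps simp flip: secant_def)

text \<open>The normal is orthogonal to \<open>v1 base + tilt\<close>. This is the damping of
  tangential terms.\<close>

lemma normal_v1: "\<bar>v1 base \<bullet> normal\<bar> \<le> norm tilt"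
proof -
  have "normal \<bullet> (v1 base + tilt) = 0"
    using normal_secant D_pos by (simp add: secant_tilt)
  then have "v1 base \<bullet> normal = - (tilt \<bullet> normal)"
    by (simp add: inner_add_right inner_commute)
  then show ?thesis using Cauchy_Schwarz_ineq2[of tilt normal] norm_normal by simp
qed

text \<open>The summands match, in this order, the five terms into which
  \<open>detail_quartic\<close> splits the detail.\<close>

definition Cdetail :: real where
  "Cdetail = 2 * Coffset + A * (2 * (real R)\<^sup>2 * B) * Ctilt + M * (A * (8 * real R ^ 4 * B\<^sup>2))
     + M * (A * (24 * real R ^ 4 * B)) + A * (16 * M * real R ^ 4)"

lemma detail_quartic:
  assumes offset: "\<bar>s' - base\<bar> \<le> Coffset * h ^ 4" and near: "M * \<bar>s' - base\<bar> \<le> 1 / 8"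
    and detail: "v s' = predicted_point \<omega> p a (v \<circ> s) K + d *\<^sub>R normal"
  shows "\<bar>d\<bar> \<le> Cdetail * h ^ 4"
proof -
  have nn: "normal \<bullet> normal = 1" using norm_normal by (simp add: dot_square_norm)
  have n: "\<bar>x \<bullet> normal\<bar> \<le> norm x" for x
    using Cauchy_Schwarz_ineq2[of x normal] norm_normal by simp
  \<comment> \<open>Orthogonal projection onto the line keeps the component along
    \<open>normal\<close>, so the base point of the line drops out.\<close>
  have "(v s' - subdiv a (v \<circ> s) K) \<bullet> normal = d"
    unfolding detail predicted_point_def line_projection_def normal_def[symmetric]
    by (simp add: inner_add_left inner_diff_left nn)
  then have "d = (v s' - v base) \<bullet> normal - (subdiv a (v \<circ> s) K - v base) \<bullet> normal"
    by (simp add: inner_diff_left)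
  also have "(subdiv a (v \<circ> s) K - v base) \<bullet> normal = subdiv a u K * (v1 base \<bullet> normal)
      + subdiv a (\<lambda>k. (u k)\<^sup>2) K * (((1 / 2) *\<^sub>R v2 base) \<bullet> normal)
      + subdiv a (\<lambda>k. u k ^ 3) K * (((1 / 6) *\<^sub>R v3 base) \<bullet> normal)
      + subdiv a (\<lambda>k. remainder base (u k)) K \<bullet> normal"
    unfolding T_points by (simp only: inner_add_left inner_scaleR_left)
  finally have d: "d = (v s' - v base) \<bullet> normal - (subdiv a u K * (v1 base \<bullet> normal)
      + subdiv a (\<lambda>k. (u k)\<^sup>2) K * (((1 / 2) *\<^sub>R v2 base) \<bullet> normal)
      + subdiv a (\<lambda>k. u k ^ 3) K * (((1 / 6) *\<^sub>R v3 base) \<bullet> normal)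
      + subdiv a (\<lambda>k. remainder base (u k)) K \<bullet> normal)" .
  have "\<bar>(v s' - v base) \<bullet> normal\<bar> \<le> 2 * Coffset * h ^ 4"
  proof -
    define t where "t = s' - base"
    have "norm (v s' - v base) \<le> norm (t *\<^sub>R v1 base) + norm (v s' - v base - t *\<^sub>R v1 base)"
      by (rule norm_triangle_sub)
    also have "\<dots> \<le> \<bar>t\<bar> + M * t\<^sup>2"
      using taylor_1[of base t] by (simp add: norm_v1 t_def)
    also have "M * t\<^sup>2 = (M * \<bar>t\<bar>) * \<bar>t\<bar>" by (simp add: power2_eq_square)
    also have "\<dots> \<le> 1 / 8 * \<bar>t\<bar>" using near by (intro mult_right_mono) (auto simp: t_def)
    finally have "norm (v s' - v base) \<le> 2 * \<bar>t\<bar>" by simp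
    then show ?thesis using offset n[of "v s' - v base"] by (simp add: t_def)
  qed
  moreover have "\<bar>subdiv a u K * (v1 base \<bullet> normal)\<bar> \<le> A * (2 * (real R)\<^sup>2 * B) * Ctilt * h ^ 4"
  proof -
    have "\<bar>v1 base \<bullet> normal\<bar> \<le> Ctilt * h\<^sup>2" using normal_v1 norm_tilt by linarith
    then have "\<bar>subdiv a u K\<bar> * \<bar>v1 base \<bullet> normal\<bar>
        \<le> (A * (2 * (real R)\<^sup>2 * H2)) * (Ctilt * h\<^sup>2)"
      using A_nonneg H2_nonneg by (intro mult_mono T_u) auto
    then show ?thesis by (simp add: abs_mult H2_le eval_nat_numeral mult_ac)
  qed
  moreover have "\<bar>subdiv a (\<lambda>k. (u k)\<^sup>2) K * (((1 / 2) *\<^sub>R v2 base) \<bullet> normal)\<bar>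
      \<le> M * (A * (8 * real R ^ 4 * B\<^sup>2)) * h ^ 4"
  proof -
    have "\<bar>((1 / 2) *\<^sub>R v2 base) \<bullet> normal\<bar> \<le> M"
      using n[of "(1 / 2) *\<^sub>R v2 base"] v2_le[of base] norm_ge_zero[of "v2 base"]
      unfolding norm_scaleR by simp
    then have "\<bar>subdiv a (\<lambda>k. (u k)\<^sup>2) K\<bar> * \<bar>((1 / 2) *\<^sub>R v2 base) \<bullet> normal\<bar>
        \<le> (A * (8 * real R ^ 4 * B\<^sup>2) * h ^ 4) * M"
      using A_nonneg B_ge by (intro mult_mono T_u_square) auto
    then show ?thesis by (simp only: abs_mult mult_ac)
  qed
  moreover have "\<bar>subdiv a (\<lambda>k. u k ^ 3) K * (((1 / 6) *\<^sub>R v3 base) \<bullet> normal)\<bar>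
      \<le> M * (A * (24 * real R ^ 4 * B)) * h ^ 4"
  proof -
    have "\<bar>((1 / 6) *\<^sub>R v3 base) \<bullet> normal\<bar> \<le> M"
      using n[of "(1 / 6) *\<^sub>R v3 base"] v3_le[of base] norm_ge_zero[of "v3 base"]
      unfolding norm_scaleR by simp
    then have "\<bar>subdiv a (\<lambda>k. u k ^ 3) K\<bar> * \<bar>((1 / 6) *\<^sub>R v3 base) \<bullet> normal\<bar>
        \<le> (A * (24 * real R ^ 4 * h\<^sup>2 * H2)) * M"
      using A_nonneg H2_nonneg by (intro mult_mono T_u_cube) auto
    also have "\<dots> = M * (A * (24 * real R ^ 4 * B)) * h ^ 4"
      by (simp add: H2_le eval_nat_numeral mult_ac)
    finally show ?thesis by (simp only: abs_mult)
  qed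
  moreover have "\<bar>subdiv a (\<lambda>k. remainder base (u k)) K \<bullet> normal\<bar> \<le> A * (16 * M * real R ^ 4) * h ^ 4"
    using n T_remainder by (rule order_trans)
  moreover have "\<bar>x0 - (x1 + x2 + x3 + x4)\<bar> \<le> (c0 + c1 + c2 + c3 + c4) * q"
    if "\<bar>x0\<bar> \<le> c0 * q" "\<bar>x1\<bar> \<le> c1 * q" "\<bar>x2\<bar> \<le> c2 * q" "\<bar>x3\<bar> \<le> c3 * q" "\<bar>x4\<bar> \<le> c4 * q"
    for x0 x1 x2 x3 x4 c0 c1 c2 c3 c4 q :: real
  proof -
    have "\<bar>x0 - (x1 + x2 + x3 + x4)\<bar> \<le> \<bar>x0\<bar> + \<bar>x1\<bar> + \<bar>x2\<bar> + \<bar>x3\<bar> + \<bar>x4\<bar>" by arith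
    with that show ?thesis unfolding distrib_right by linarith
  qed
  ultimately show ?thesis unfolding d Cdetail_def by blast
qed

end

section \<open>Decay of the differences of the parameters\<close>

lemma fdiff_funpow_bspline:
  "n \<le> p \<Longrightarrow> (fdiff ^^ n) (bspline p x) = (\<lambda>K. ((1 / 2) ^ n) *\<^sub>R bspline (p - n) ((fdiff ^^ n) x) K)"
proof (induction n)
  case (Suc n)
  define y where "y = (fdiff ^^ n) x"
  have scale: "fdiff (\<lambda>K. c *\<^sub>R f K) = (\<lambda>K. c *\<^sub>R fdiff f K)" for c and f :: "int \<Rightarrow> 'a"
    by (simp add: fdiff_def[abs_def] scaleR_diff_right)
  have "p - n = Suc (p - Suc n)" using Suc.prems by simp
  then have "fdiff (bspline (p - n) y) = (\<lambda>K. (1 / 2) *\<^sub>R bspline (p - Suc n) (fdiff y) K)"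
    by (simp only: fdiff_bspline)
  moreover have "(fdiff ^^ n) (bspline p x) = (\<lambda>K. (1 / 2) ^ n *\<^sub>R bspline (p - n) y K)"
    using Suc by (simp add: y_def)
  ultimately show ?case by (simp add: scale y_def mult.commute)
qed simp

lemma fdiff_funpow_add:
  "(fdiff ^^ n) (\<lambda>k. x k + y k) = (\<lambda>k. (fdiff ^^ n) x k + (fdiff ^^ n) y k)"
  by (induction n) (auto simp: fdiff_def algebra_simps)

lemma fdiff_funpow_bound:
  fixes x :: "int \<Rightarrow> real"
  assumes "\<And>k. \<bar>x k\<bar> \<le> B"
  shows "\<bar>(fdiff ^^ n) x k\<bar> \<le> 2 ^ n * B"
proof (induction n arbitrary: k)
  case (Suc n)
  show ?case using Suc[of k] Suc[of "k + 1"] by (simp add: fdiff_def)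
qed (simp add: assms)

text \<open>The perturbation decays faster than \<open>\<mu> ^ j\<close> by a factor
  \<open>(1 / 2) ^ j\<close>, so its accumulated effect stays bounded. Quantifying
  \<open>step\<close> over all bounds \<open>e\<close> avoids suprema.\<close>

lemma geometric_recursion:
  fixes x :: "nat \<Rightarrow> int \<Rightarrow> real"
  assumes \<mu>: "\<mu> > 0" and C: "C \<ge> 0" and b: "\<And>i. \<bar>x J i\<bar> \<le> b"
    and step: "\<And>j e i. j \<ge> J \<Longrightarrow> (\<And>k. \<bar>x j k\<bar> \<le> e) \<Longrightarrow> \<bar>x (Suc j) i\<bar> \<le> \<mu> * e + C * (\<mu> / 2) ^ j"
  shows "\<exists>B. \<forall>j\<ge>J. \<forall>i. \<bar>x j i\<bar> \<le> B * \<mu> ^ j"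
proof -
  \<comment> \<open>Chosen so that \<open>\<mu> ^ j * (B - D * (1 / 2) ^ j)\<close> satisfies the
    recursion with equality.\<close>
  define D where "D = 2 * C / \<mu>"
  define B where "B = b / \<mu> ^ J + D"
  have D: "D \<ge> 0" using C \<mu> by (simp add: D_def)
  have "\<forall>i. \<bar>x j i\<bar> \<le> \<mu> ^ j * (B - D * (1 / 2) ^ j)" if "j \<ge> J" for j
    using that
  proof (induction j rule: dec_induct)
    case base
    have "D * (1 / 2) ^ J \<le> D * 1" using D by (intro mult_left_mono) (auto simp: power_le_one)
    then have "\<mu> ^ J * (b / \<mu> ^ J) \<le> \<mu> ^ J * (B - D * (1 / 2) ^ J)"
      using \<mu> by (intro mult_left_mono) (auto simp: B_def)
    then have "b \<le> \<mu> ^ J * (B - D * (1 / 2) ^ J)" using \<mu> by simp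
    then show ?case using b order_trans by blast
  next
    case (step n)
    show ?case
    proof
      fix i
      have "\<bar>x (Suc n) i\<bar> \<le> \<mu> * (\<mu> ^ n * (B - D * (1 / 2) ^ n)) + C * (\<mu> / 2) ^ n"
        using step assms(4) by blast
      also have "\<dots> = \<mu> ^ Suc n * (B - D * (1 / 2) ^ Suc n)"
        using \<mu> by (simp add: D_def field_simps power_divide)
      finally show "\<bar>x (Suc n) i\<bar> \<le> \<mu> ^ Suc n * (B - D * (1 / 2) ^ Suc n)" .
    qed
  qed
  moreover have "\<mu> ^ j * (B - D * (1 / 2) ^ j) \<le> B * \<mu> ^ j" for j
    using D \<mu> by (simp add: algebra_simps)
  ultimately show ?thesis by (meson order_trans)
qed

lemma eventually_geometric_le:
  fixes c C :: real
  assumes "C > 0"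
  shows "\<exists>J. \<forall>j\<ge>J. c * (1 / 2) ^ j \<le> C"
proof -
  have "(\<lambda>j. c * (1 / 2) ^ j) \<longlonglongrightarrow> c * 0"
    by (intro tendsto_mult tendsto_const LIMSEQ_realpow_zero) auto
  then have "\<forall>\<^sub>F j in sequentially. c * (1 / 2) ^ j < C"
    using assms by (auto dest: order_tendstoD)
  then show ?thesis unfolding eventually_sequentially by (meson less_imp_le)
qed

text \<open>What drives the parameters: each new point is orthogonally above the average with
  respect to the secant, and mesh width and offset tend to zero uniformly.\<close>

locale normal_iteration = unit_speed +
  fixes p :: nat and s :: "nat \<Rightarrow> int \<Rightarrow> real"
  assumes p_ge: "p \<ge> 3" and s_mono: "strict_mono (s j)"
    and ortho: "(v (s (Suc j) K) - bspline p (v \<circ> s j) K) \<bullet> bspline (p - 2) (fdiff (v \<circ> s j)) K = 0"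
    and small: "\<epsilon> > 0 \<Longrightarrow> \<exists>J. \<forall>j\<ge>J. (\<forall>k. fdiff (s j) k \<le> \<epsilon>) \<and>
      (\<forall>K. \<bar>s (Suc j) K - bspline p (s j) K\<bar> \<le> \<epsilon>)"
begin

definition offset :: "nat \<Rightarrow> int \<Rightarrow> real" where "offset j K = s (Suc j) K - bspline p (s j) K"

lemma normal_step: "normal_step v v1 v2 v3 M p (s j)"
  using p_ge s_mono by unfold_locales auto

lemma fdiff_pos: "fdiff (s j) k > 0"
  using s_mono by (simp add: fdiff_def strict_mono_less)

text \<open>The new parameters are \<open>S\<^sub>p\<close> of the old ones plus the offset; the
  first part is contracted, the second is bounded crudely.\<close>

lemma difference_step:
  assumes "n \<le> 3" and e: "\<And>k. \<bar>(fdiff ^^ n) (s j) k\<bar> \<le> e" and E: "\<And>K. \<bar>offset j K\<bar> \<le> E"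
  shows "\<bar>(fdiff ^^ n) (s (Suc j)) i\<bar> \<le> (1 / 2) ^ n * e + 2 ^ n * E"
proof -
  have "s (Suc j) = (\<lambda>k. bspline p (s j) k + offset j k)" by (simp add: offset_def)
  then have "(fdiff ^^ n) (s (Suc j)) i
      = (1 / 2) ^ n * bspline (p - n) ((fdiff ^^ n) (s j)) i + (fdiff ^^ n) (offset j) i"
    using assms(1) p_ge by (simp only: fdiff_funpow_add) (simp add: fdiff_funpow_bspline)
  moreover have "\<bar>bspline (p - n) ((fdiff ^^ n) (s j)) i\<bar> \<le> e"
    using bspline_norm_le[of i "p - n" "(fdiff ^^ n) (s j)" e] e by simp
  then have "\<bar>(1 / 2) ^ n * bspline (p - n) ((fdiff ^^ n) (s j)) i\<bar> \<le> (1 / 2) ^ n * e"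
    by (simp add: abs_mult)
  moreover have "\<bar>(fdiff ^^ n) (offset j) i\<bar> \<le> 2 ^ n * E" using E by (rule fdiff_funpow_bound)
  ultimately show ?thesis by linarith
qed

lemma offset_cubic:
  assumes h: "\<And>k. fdiff (s j) k \<le> h" and "20 * M * 2 ^ p * (real p * h) \<le> 1"
    and "M * \<bar>offset j K\<bar> \<le> 1 / 8"
  shows "\<bar>offset j K\<bar> \<le> 16 * M\<^sup>2 * 2 ^ p * real p ^ 3 * h ^ 3"
proof -
  interpret normal_step v v1 v2 v3 M p "s j" K by (rule normal_step)
  show ?thesis
    using offset_cubic[of h "s (Suc j) K"] assms ortho[of j K]
    by (simp add: offset_def base_def secant_def power_mult_distrib mult.assoc)
qed

text \<open>The recursion \<open>h \<mapsto> h / 2 + C h\<^sup>3\<close> for the mesh width is dominated by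
  \<open>\<epsilon> 2\<^sup>-\<^sup>n (2 - 2\<^sup>-\<^sup>n)\<close>, provided that it starts from a small \<open>\<epsilon>\<close>.\<close>

lemma first_differences:
  "\<exists>J c C. c > 0 \<and> C \<ge> 0 \<and> (\<forall>j\<ge>J. (\<forall>k. fdiff (s j) k \<le> c * (1 / 2) ^ j) \<and>
     (\<forall>K. M * \<bar>offset j K\<bar> \<le> 1 / 8) \<and> (\<forall>K. \<bar>offset j K\<bar> \<le> C * (1 / 8) ^ j))"
proof -
  define C1 where "C1 = 16 * M\<^sup>2 * 2 ^ p * real p ^ 3"
  have C1: "C1 \<ge> 0" using M_ge by (simp add: C1_def)
  \<comment> \<open>The first entry gives the smallness required by \<open>offset_cubic\<close> at
    mesh width \<open>2 * \<epsilon>\<close>, the second the nearness; the last two absorb the cubic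
    perturbation through \<open>64 * C1 * \<epsilon>\<^sup>2 \<le> 1\<close>.\<close>
  define \<epsilon> where "\<epsilon> = Min {1 / (40 * M * 2 ^ p * real p), 1 / (8 * M), 1 / (64 * (C1 + 1)), 1}"
  have \<epsilon>: "\<epsilon> > 0" "\<epsilon> \<le> 1"
    "\<epsilon> \<le> 1 / (40 * M * 2 ^ p * real p)" "\<epsilon> \<le> 1 / (8 * M)" "\<epsilon> \<le> 1 / (64 * (C1 + 1))"
    using M_ge p_ge C1
    by (simp add: \<epsilon>_def, unfold \<epsilon>_def) (rule Min_le; simp)+
  have \<epsilon>1: "20 * M * 2 ^ p * (real p * (2 * \<epsilon>)) \<le> 1"
    using \<epsilon>(3) M_ge p_ge by (simp add: field_simps)
  have \<epsilon>2: "M * \<epsilon> \<le> 1 / 8" using \<epsilon>(4) M_ge by (simp add: field_simps)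
  have \<epsilon>3: "64 * C1 * \<epsilon>\<^sup>2 \<le> 1"
  proof -
    have "64 * (C1 + 1) * \<epsilon> \<le> 1" using \<epsilon>(5) C1 by (simp add: field_simps)
    then have "64 * C1 * \<epsilon> \<le> 1" using \<epsilon>(1) by (simp add: algebra_simps)
    then have "64 * C1 * \<epsilon> * \<epsilon> \<le> 1 * 1" using \<epsilon> by (intro mult_mono) auto
    then show ?thesis by (simp add: power2_eq_square mult_ac)
  qed
  obtain J where J: "\<And>j k. j \<ge> J \<Longrightarrow> fdiff (s j) k \<le> \<epsilon>" "\<And>j K. j \<ge> J \<Longrightarrow> \<bar>offset j K\<bar> \<le> \<epsilon>"
    using small[OF \<epsilon>(1)] unfolding offset_def by blast
  have near: "M * \<bar>offset j K\<bar> \<le> 1 / 8" if "j \<ge> J" for j K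
    using mult_left_mono[OF J(2)[OF that], of M K] M_ge \<epsilon>2 by linarith
  define f where "f n = \<epsilon> * (1 / 2) ^ n * (2 - (1 / 2) ^ n)" for n :: nat
  have f2: "f n \<le> 2 * \<epsilon> * (1 / 2) ^ n" and f0: "f n \<ge> 0" for n
    using \<epsilon>(1) power_le_one[of "1 / 2 :: real" n] by (auto simp: f_def algebra_simps)
  have f2': "f n \<le> 2 * \<epsilon>" for n
  proof -
    have "2 * \<epsilon> * (1 / 2) ^ n \<le> 2 * \<epsilon> * 1"
      using \<epsilon>(1) by (intro mult_left_mono) (auto simp: power_le_one)
    then show ?thesis using f2[of n] by linarith
  qed
  have off: "\<bar>offset (J + n) K\<bar> \<le> C1 * f n ^ 3" if "\<And>k. fdiff (s (J + n)) k \<le> f n" for n K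
  proof -
    have "20 * M * 2 ^ p * (real p * f n) \<le> 20 * M * 2 ^ p * (real p * (2 * \<epsilon>))"
      using f2' M_ge by (intro mult_left_mono) auto
    then have "20 * M * 2 ^ p * (real p * f n) \<le> 1" using \<epsilon>1 by (rule order_trans)
    then show ?thesis
      unfolding C1_def using near by (intro offset_cubic that) auto
  qed
  have h: "fdiff (s (J + n)) k \<le> f n" for n k
  proof (induction n arbitrary: k)
    case 0
    show ?case using J(1)[of J k] by (simp add: f_def)
  next
    case (Suc n)
    define t :: real where "t = (1 / 2) ^ n"
    have t: "0 \<le> t" "t \<le> 1" by (auto simp: t_def power_le_one)
    have "\<bar>fdiff (s (Suc (J + n))) k\<bar> \<le> 1 / 2 * f n + 2 * (C1 * f n ^ 3)"
      using difference_step[of 1 "J + n" "f n" "C1 * f n ^ 3" k] Suc fdiff_pos[of "J + n"] off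
      by (simp add: less_imp_le)
    also have "f n ^ 3 \<le> (2 * \<epsilon> * t) ^ 3" unfolding t_def using f2 f0 by (intro power_mono) auto
    then have "1 / 2 * f n + 2 * (C1 * f n ^ 3) \<le> 1 / 2 * f n + 2 * (C1 * (2 * \<epsilon> * t) ^ 3)"
      using C1 by (intro add_mono mult_left_mono) auto
    also have "\<dots> = 1 / 2 * f n + (64 * C1 * \<epsilon>\<^sup>2) * (\<epsilon> * t ^ 3 / 4)"
      by (simp add: power2_eq_square power3_eq_cube)
    also have "\<dots> \<le> 1 / 2 * f n + 1 * (\<epsilon> * t\<^sup>2 / 4)"
      using \<epsilon>3 t \<epsilon>(1) C1
      by (intro add_left_mono mult_mono divide_right_mono mult_left_mono power_decreasing) auto
    \<comment> \<open>\<open>f (Suc n)\<close> exceeds \<open>f n / 2\<close> by exactly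
      \<open>\<epsilon> * t\<^sup>2 / 4\<close>, the room reserved for the cubic term.\<close>
    also have "\<dots> = f (Suc n)"
      by (simp add: f_def t_def power2_eq_square field_simps)
    finally show ?case by simp
  qed
  \<comment> \<open>The factor \<open>2 ^ J\<close> passes from levels counted from \<open>J\<close>
    to absolute levels.\<close>
  define c where "c = 2 * \<epsilon> * 2 ^ J"
  have fc: "f (j - J) \<le> c * (1 / 2) ^ j" if "j \<ge> J" for j
  proof -
    have "2 ^ J * (1 / 2 :: real) ^ j = (1 / 2) ^ (j - J)"
      using that by (simp add: power_diff power_divide)
    then show ?thesis using f2[of "j - J"] by (simp add: c_def mult.assoc)
  qed
  have "fdiff (s j) k \<le> c * (1 / 2) ^ j" if "j \<ge> J" for j k
    using h[of "j - J" k] fc[OF that] that by simp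
  moreover have "\<bar>offset j K\<bar> \<le> (C1 * c ^ 3) * (1 / 8) ^ j" if "j \<ge> J" for j K
  proof -
    have "\<bar>offset j K\<bar> \<le> C1 * f (j - J) ^ 3" using off[of "j - J" K, OF h] that by simp
    also have "\<dots> \<le> C1 * (c * (1 / 2) ^ j) ^ 3"
      using fc[OF that] f0 C1 by (intro mult_left_mono power_mono) auto
    also have "\<dots> = (C1 * c ^ 3) * ((1 / 2) ^ 3) ^ j"
      by (simp add: power_mult_distrib flip: power_mult) (simp add: mult.commute)
    finally show ?thesis by (simp add: power3_eq_cube)
  qed
  moreover have "c > 0" "C1 * c ^ 3 \<ge> 0" using \<epsilon>(1) C1 by (auto simp: c_def)
  ultimately show ?thesis using near by blast
qed

text \<open>The offset decays one order faster than the contraction rate of the \<open>n\<close>-th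
  differences, so \<open>geometric_recursion\<close> applies with
  \<open>\<mu> = (1 / 2) ^ n\<close>.\<close>

lemma higher_differences:
  assumes "n \<in> {2, 3}" and C: "C \<ge> 0"
    and J: "\<And>j k. j \<ge> J \<Longrightarrow> fdiff (s j) k \<le> c * (1 / 2) ^ j"
    and offset: "\<And>j K. j \<ge> J \<Longrightarrow> \<bar>offset j K\<bar> \<le> C * ((1 / 2) ^ Suc n) ^ j"
  shows "\<exists>B. \<forall>j\<ge>J. \<forall>k. \<bar>(fdiff ^^ n) (s j) k\<bar> \<le> B * ((1 / 2) ^ n) ^ j"
proof -
  obtain m where n: "n = Suc m" using assms(1) by (cases n) auto
  have "\<bar>fdiff (s J) k\<bar> \<le> c * (1 / 2) ^ J" for k
    using J[of J k] fdiff_pos[of J k] by simp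
  then have b: "\<bar>(fdiff ^^ n) (s J) i\<bar> \<le> 2 ^ m * (c * (1 / 2) ^ J)" for i
    using fdiff_funpow_bound[of "fdiff (s J)" _ m i] by (simp add: n funpow_swap1)
  have "\<bar>(fdiff ^^ n) (s (Suc j)) i\<bar> \<le> (1 / 2) ^ n * e + 2 ^ n * C * ((1 / 2) ^ n / 2) ^ j"
    if j: "j \<ge> J" and e: "\<And>k. \<bar>(fdiff ^^ n) (s j) k\<bar> \<le> e" for j e i
  proof -
    have "n \<le> 3" using assms(1) by auto
    from difference_step[OF this e offset[OF j]] show ?thesis
      by (simp add: mult_ac)
  qed
  then show ?thesis
    by (intro geometric_recursion[where C = "2 ^ n * C" and J = J
          and x = "\<lambda>j. (fdiff ^^ n) (s j)" and b = "2 ^ m * (c * (1 / 2) ^ J)"] b) (use C in auto)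
qed

text \<open>Two rounds of the bootstrap: the cubic offset yields second differences, these yield the
  quartic offset, and that yields third differences.\<close>

lemma smooth_parameters:
  assumes R: "R \<ge> p"
  shows "\<exists>J c B. \<forall>j\<ge>J.
     smooth_step v v1 v2 v3 M p (s j) R (c * (1 / 2) ^ j) (B * (c * (1 / 2) ^ j)\<^sup>2) B \<and>
     (\<forall>K. M * \<bar>offset j K\<bar> \<le> 1 / 8) \<and> (\<forall>k. \<bar>(fdiff ^^ 3) (s j) k\<bar> \<le> B * (c * (1 / 2) ^ j) ^ 3)"
proof -
  obtain J c C where c: "c > 0" and C: "C \<ge> 0"
    and h: "\<And>j k. j \<ge> J \<Longrightarrow> fdiff (s j) k \<le> c * (1 / 2) ^ j"
    and near: "\<And>j K. j \<ge> J \<Longrightarrow> M * \<bar>offset j K\<bar> \<le> 1 / 8"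
    and off: "\<And>j K. j \<ge> J \<Longrightarrow> \<bar>offset j K\<bar> \<le> C * (1 / 8) ^ j"
    using first_differences by blast
  obtain B2 where B2: "\<And>j k. j \<ge> J \<Longrightarrow> \<bar>(fdiff ^^ 2) (s j) k\<bar> \<le> B2 * ((1 / 2)\<^sup>2) ^ j"
  proof -
    have "\<exists>B. \<forall>j\<ge>J. \<forall>k. \<bar>(fdiff ^^ 2) (s j) k\<bar> \<le> B * ((1 / 2)\<^sup>2) ^ j"
      by (rule higher_differences[OF _ C h]) (use off in \<open>auto simp: power3_eq_cube\<close>)
    then show ?thesis using that by blast
  qed
  \<comment> \<open>Proved for every large \<open>B\<close> because it is used twice: first with
    \<open>Ba\<close>, then with the constant that also dominates the third differences.\<close>
  have smooth: "\<exists>J'\<ge>J. \<forall>j\<ge>J'. smooth_step v v1 v2 v3 M p (s j) R (c * (1 / 2) ^ j)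
      (B * (c * (1 / 2) ^ j)\<^sup>2) B" if B: "B \<ge> 1" "B \<ge> B2 / c\<^sup>2" for B
  proof -
    define C' where "C' = 44 * M * 2 ^ p * (real R)\<^sup>2 * B"
    obtain J1 where J1: "\<And>j. j \<ge> J1 \<Longrightarrow> c * (1 / 2) ^ j \<le> 1"
      using eventually_geometric_le[of 1 c] by auto
    obtain J2 where J2: "\<And>j. j \<ge> J2 \<Longrightarrow> C' * c * (1 / 2) ^ j \<le> 1"
      using eventually_geometric_le[of 1 "C' * c"] by auto
    have "smooth_step v v1 v2 v3 M p (s j) R (c * (1 / 2) ^ j) (B * (c * (1 / 2) ^ j)\<^sup>2) B"
      if j: "j \<ge> max J (max J1 J2)" for j
    proof -
      have "\<bar>fdiff (fdiff (s j)) k\<bar> \<le> B * (c * (1 / 2) ^ j)\<^sup>2" for k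
      proof -
        have "\<bar>fdiff (fdiff (s j)) k\<bar> \<le> B2 * ((1 / 2)\<^sup>2) ^ j"
          using B2[of j k] j by (simp add: eval_nat_numeral)
        also have "B2 * ((1 / 2)\<^sup>2) ^ j \<le> (B * c\<^sup>2) * ((1 / 2)\<^sup>2) ^ j"
          using B(2) c by (intro mult_right_mono) (auto simp: field_simps)
        also have "\<dots> = B * (c * (1 / 2) ^ j)\<^sup>2"
          by (simp add: power_mult_distrib flip: power_mult) (simp add: mult.commute)
        finally show ?thesis .
      qed
      then show ?thesis
        using normal_step[of j] h[of j] J1[of j] J2[of j] j R B(1)
        by (auto simp: smooth_step_def controlled_step_def smooth_step_axioms_def
            controlled_step_axioms_def C'_def mult.assoc)
    qed
    then show ?thesis by (meson max.cobounded1)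
  qed
  define Ba where "Ba = max 1 (B2 / c\<^sup>2)"
  obtain J' where J': "J' \<ge> J" and smooth': "\<And>j. j \<ge> J' \<Longrightarrow>
      smooth_step v v1 v2 v3 M p (s j) R (c * (1 / 2) ^ j) (Ba * (c * (1 / 2) ^ j)\<^sup>2) Ba"
    using smooth[of Ba] by (auto simp: Ba_def)
  define C4 where "C4 = 74 * M\<^sup>2 * 2 ^ p * real R ^ 4 * Ba"
  have off4: "\<bar>offset j K\<bar> \<le> (C4 * c ^ 4) * ((1 / 2) ^ 4) ^ j" if j: "j \<ge> J'" for j K
  proof -
    interpret smooth_step v v1 v2 v3 M p "s j" K R "c * (1 / 2) ^ j" "Ba * (c * (1 / 2) ^ j)\<^sup>2" Ba
      using smooth'[OF j] .
    have "\<bar>offset j K\<bar> \<le> C4 * (c * (1 / 2) ^ j) ^ 4"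
      using offset_quartic[of "s (Suc j) K"] near[of j K] ortho[of j K] j J'
      by (simp add: offset_def base_def secant_def C4_def Coffset_def)
    also have "\<dots> = (C4 * c ^ 4) * ((1 / 2) ^ 4) ^ j"
      by (simp add: power_mult_distrib flip: power_mult) (simp add: mult.commute)
    finally show ?thesis .
  qed
  have C4: "C4 * c ^ 4 \<ge> 0" using c by (simp add: C4_def Ba_def)
  obtain B3 where B3: "\<And>j k. j \<ge> J' \<Longrightarrow> \<bar>(fdiff ^^ 3) (s j) k\<bar> \<le> B3 * ((1 / 2) ^ 3) ^ j"
  proof -
    have "\<exists>B. \<forall>j\<ge>J'. \<forall>k. \<bar>(fdiff ^^ 3) (s j) k\<bar> \<le> B * ((1 / 2) ^ 3) ^ j"
      by (rule higher_differences[OF _ C4 h]) (use off4 J' in \<open>auto simp: eval_nat_numeral\<close>)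
    then show ?thesis using that by blast
  qed
  define B where "B = max Ba (B3 / c ^ 3)"
  have B: "B \<ge> 1" "B \<ge> B2 / c\<^sup>2" by (auto simp: B_def Ba_def)
  obtain J3 where J3: "J3 \<ge> J" and smooth3: "\<And>j. j \<ge> J3 \<Longrightarrow>
      smooth_step v v1 v2 v3 M p (s j) R (c * (1 / 2) ^ j) (B * (c * (1 / 2) ^ j)\<^sup>2) B"
    using smooth[OF B] by auto
  have "\<bar>(fdiff ^^ 3) (s j) k\<bar> \<le> B * (c * (1 / 2) ^ j) ^ 3" if "j \<ge> J'" for j k
  proof -
    note B3[OF that, of k]
    also have "B3 * ((1 / 2) ^ 3) ^ j \<le> (B * c ^ 3) * ((1 / 2) ^ 3) ^ j"
      using c by (intro mult_right_mono) (auto simp: B_def pos_divide_le_eq[symmetric])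
    also have "\<dots> = B * (c * (1 / 2) ^ j) ^ 3"
      by (simp add: power_mult_distrib flip: power_mult) (simp add: mult.commute)
    finally show ?thesis .
  qed
  then show ?thesis
    using smooth3 near J' J3 by (intro exI[of _ "max J' J3"] exI[of _ c] exI[of _ B]) auto
qed

end

section \<open>Convergence and decay of the details\<close>

lemma pl_interpolant_grid: "pl_interpolant j x (real_of_int i / 2 ^ j) = x i"
  by (simp add: pl_interpolant_def)

text \<open>Subtracting the linear function of slope \<open>L / P\<close> makes
  \<open>\<sigma>\<close> periodic, so both points can be translated into one compact
  interval.\<close>

lemma periodic_limit_uniformly_continuous:
  fixes \<sigma> :: "real \<Rightarrow> real"
  assumes cont: "continuous_on UNIV \<sigma>" and P: "P > 0"
    and per: "\<And>t. \<sigma> (t + P) = \<sigma> t + L" and "\<epsilon> > 0"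
  shows "\<exists>\<delta>>0. \<forall>t t'. \<bar>t - t'\<bar> < \<delta> \<longrightarrow> \<bar>\<sigma> t - \<sigma> t'\<bar> < \<epsilon>"
proof -
  have shift: "\<sigma> (t + of_int n * P) - of_int n * L = \<sigma> t" for t n
  proof -
    define g where "g = (\<lambda>t. \<sigma> t - t / P * L)"
    have "g (t + P) = g t" for t unfolding g_def per using P by (simp add: field_simps)
    from periodic_int[of g P, OF this, of t n] show ?thesis
      using P by (simp add: g_def add_divide_distrib distrib_right)
  qed
  \<comment> \<open>The margin 1 on either side leaves room for the second point, at distance less
    than 1 from the first.\<close>
  have "uniformly_continuous_on {-1..P + 1} \<sigma>"
    by (intro compact_uniformly_continuous continuous_on_subset[OF cont]) auto
  then obtain \<delta> where \<delta>: "\<delta> > 0"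
    "\<And>t t'. t \<in> {-1..P + 1} \<Longrightarrow> t' \<in> {-1..P + 1} \<Longrightarrow> \<bar>t' - t\<bar> < \<delta> \<Longrightarrow> \<bar>\<sigma> t' - \<sigma> t\<bar> < \<epsilon>"
    using \<open>\<epsilon> > 0\<close> unfolding uniformly_continuous_on_def dist_real_def by metis
  have "\<bar>\<sigma> t - \<sigma> t'\<bar> < \<epsilon>" if "\<bar>t - t'\<bar> < min \<delta> 1" for t t'
  proof -
    define n where "n = \<lfloor>t / P\<rfloor>"
    have "of_int n \<le> t / P" "t / P < of_int n + 1" by (auto simp: n_def)
    then have n: "0 \<le> t - of_int n * P" "t - of_int n * P < P"
      using P by (auto simp: field_simps)
    have "\<bar>\<sigma> (t - of_int n * P) - \<sigma> (t' - of_int n * P)\<bar> < \<epsilon>"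
      using n that by (intro \<delta>(2)) auto
    then show ?thesis
      using shift[of "t - of_int n * P" n] shift[of "t' - of_int n * P" n] by simp
  qed
  then show ?thesis using \<delta>(1) by (intro exI[of _ "min \<delta> 1"]) auto
qed

text \<open>The two indices sit at grid points at most \<open>q / 2 ^ Suc j\<close> apart; uniform
  convergence at both levels and uniform continuity of the limit contribute
  \<open>\<epsilon> / 3\<close> each.\<close>

lemma convergent_levels_close:
  fixes q :: nat
  assumes conv: "transform_convergent s" and N: "N \<ge> 1"
    and per: "\<And>j i. s j (i + 2 ^ j * int N) = s j i + L" and \<epsilon>: "\<epsilon> > 0"
  shows "\<exists>J. \<forall>j\<ge>J. \<forall>i k. \<bar>2 * k - i\<bar> \<le> int q \<longrightarrow> \<bar>s j k - s (Suc j) i\<bar> \<le> \<epsilon>"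
proof -
  obtain \<sigma> where cont: "continuous_on UNIV \<sigma>"
    and lim: "uniform_limit UNIV (\<lambda>j. pl_interpolant j (s j)) \<sigma> sequentially"
    using conv by (auto simp: transform_convergent_def)
  have pl: "pl_interpolant j (s j) (t + real N) = pl_interpolant j (s j) t + L" for j t
  proof -
    have "2 ^ j * (t + real N) = 2 ^ j * t + of_int (2 ^ j * int N)" by (simp add: algebra_simps)
    then have "\<lfloor>2 ^ j * (t + real N)\<rfloor> = \<lfloor>2 ^ j * t\<rfloor> + 2 ^ j * int N"
      "frac (2 ^ j * (t + real N)) = frac (2 ^ j * t)"
      by (simp_all only: floor_add_int[symmetric] frac_def of_int_add)
    moreover have "s j (\<lfloor>2 ^ j * t\<rfloor> + 2 ^ j * int N + 1) = s j (\<lfloor>2 ^ j * t\<rfloor> + 1) + L"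
      using per[of j "\<lfloor>2 ^ j * t\<rfloor> + 1"] by (simp add: algebra_simps)
    ultimately show ?thesis by (simp add: pl_interpolant_def per)
  qed
  have pt: "(\<lambda>j. pl_interpolant j (s j) t) \<longlonglongrightarrow> \<sigma> t" for t
    using tendsto_uniform_limitI[OF lim] by simp
  have "(\<lambda>j. pl_interpolant j (s j) (t + real N)) \<longlonglongrightarrow> \<sigma> t + L" for t
    unfolding pl by (intro tendsto_add pt tendsto_const)
  then have per': "\<sigma> (t + real N) = \<sigma> t + L" for t
    using pt LIMSEQ_unique by blast
  have "real N > 0" "\<epsilon> / 3 > 0" using N \<epsilon> by auto
  from periodic_limit_uniformly_continuous[OF cont this(1) per' this(2)]
  obtain \<delta> where \<delta>: "\<delta> > 0" "\<And>t t'. \<bar>t - t'\<bar> < \<delta> \<Longrightarrow> \<bar>\<sigma> t - \<sigma> t'\<bar> < \<epsilon> / 3" by blast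
  obtain J1 where J1: "\<And>j t. j \<ge> J1 \<Longrightarrow> \<bar>pl_interpolant j (s j) t - \<sigma> t\<bar> < \<epsilon> / 3"
    using uniform_limitD[OF lim \<open>\<epsilon> / 3 > 0\<close>] by (auto simp: eventually_sequentially dist_real_def)
  obtain J2 where J2: "\<And>j. j \<ge> J2 \<Longrightarrow> real q * (1 / 2) ^ j \<le> \<delta>"
    using eventually_geometric_le[OF \<delta>(1), of "real q"] by blast
  have "\<bar>s j k - s (Suc j) i\<bar> \<le> \<epsilon>" if j: "j \<ge> max J1 J2" and ik: "\<bar>2 * k - i\<bar> \<le> int q" for j i k
  proof -
    define t where "t = real_of_int k / 2 ^ j"
    define t' where "t' = real_of_int i / 2 ^ Suc j"
    have "t - t' = real_of_int (2 * k - i) / 2 ^ Suc j" by (simp add: t_def t'_def field_simps)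
    moreover have "\<bar>real_of_int (2 * k - i)\<bar> \<le> real q"
      using ik by (metis of_int_abs of_int_le_iff of_int_of_nat_eq)
    ultimately have "\<bar>t - t'\<bar> \<le> real q / 2 ^ Suc j"
      by (simp add: abs_divide divide_right_mono)
    also have "\<dots> = real q * (1 / 2) ^ j / 2" by (simp add: power_divide)
    also have "\<dots> \<le> \<delta> / 2" using J2[of j] j by simp
    finally have "\<bar>\<sigma> t - \<sigma> t'\<bar> < \<epsilon> / 3" using \<delta> by (intro \<delta>(2)) linarith
    moreover have "\<bar>s j k - \<sigma> t\<bar> < \<epsilon> / 3"
      using J1[of j t] j by (simp add: t_def pl_interpolant_grid)
    moreover have "\<bar>s (Suc j) i - \<sigma> t'\<bar> < \<epsilon> / 3"
      using J1[of "Suc j" t'] j pl_interpolant_grid[of "Suc j" "s (Suc j)" i] by (simp add: t'_def)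
    ultimately show ?thesis by linarith
  qed
  then show ?thesis by blast
qed

text \<open>Orthogonality is membership in the normal line. Smallness comes from the closeness of
  consecutive levels, applied with index distance \<open>p\<close>.\<close>

lemma normal_iteration_of_transform:
  assumes "p \<ge> 3" and \<omega>: "\<omega> \<in> {\<i>, -\<i>}" and "unit_speed v v1 v2 v3 M"
    and tr: "normal_transform \<omega> p a v L N s d" and conv: "transform_convergent s"
  shows "normal_iteration v v1 v2 v3 M p s"
proof -
  interpret unit_speed v v1 v2 v3 M by fact
  have mono: "strict_mono (s j)" and per: "s j (i + 2 ^ j * int N) = s j i + L" and N: "N \<ge> 1"
    and step: "transform_step \<omega> p a v (s j) (s (Suc j)) (d (Suc j))" for j i
    using tr by (auto simp: normal_transform_def initial_parameters_def dest: spec[of _ "Suc j"])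
  show ?thesis
  proof
    fix j K
    let ?G = "bspline (p - 2) (fdiff (v \<circ> s j)) K"
    have "v (s (Suc j) K) \<in> normal_line \<omega> p (v \<circ> s j) K"
      using step[of j] unfolding transform_step_def by blast
    then obtain t where "v (s (Suc j) K) = bspline p (v \<circ> s j) K + t *\<^sub>R unit_normal \<omega> p (v \<circ> s j) K"
      unfolding normal_line_def by blast
    then have "v (s (Suc j) K) - bspline p (v \<circ> s j) K = t *\<^sub>R unit_normal \<omega> p (v \<circ> s j) K"
      by simp
    moreover have "unit_normal \<omega> p (v \<circ> s j) K \<bullet> ?G = 0"
      using \<omega> by (auto simp: unit_normal_def inner_complex_def algebra_simps)
    ultimately show "(v (s (Suc j) K) - bspline p (v \<circ> s j) K) \<bullet> ?G = 0" by simp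
  next
    fix \<epsilon> :: real assume "\<epsilon> > 0"
    then have "\<epsilon> / 2 > 0" by simp
    from convergent_levels_close[OF conv N per this, of p]
    obtain J where J: "\<And>j i k. j \<ge> J \<Longrightarrow> \<bar>2 * k - i\<bar> \<le> int p \<Longrightarrow> \<bar>s j k - s (Suc j) i\<bar> \<le> \<epsilon> / 2"
      by blast
    have "fdiff (s j) k \<le> \<epsilon>" if "j \<ge> J" for j k
    proof -
      \<comment> \<open>Both neighbours are compared with the same parameter of the next level, at
        index distances 0 and 2.\<close>
      have "\<bar>s j k - s (Suc j) (2 * k)\<bar> \<le> \<epsilon> / 2" by (rule J[OF that]) simp
      moreover have "\<bar>s j (k + 1) - s (Suc j) (2 * k)\<bar> \<le> \<epsilon> / 2"
        by (rule J[OF that]) (use \<open>p \<ge> 3\<close> in simp)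
      ultimately show ?thesis unfolding fdiff_def by linarith
    qed
    moreover have "\<bar>s (Suc j) K - bspline p (s j) K\<bar> \<le> \<epsilon>" if "j \<ge> J" for j K
    proof -
      have "norm (bspline p (\<lambda>k. s j k - s (Suc j) K) K) \<le> \<epsilon> / 2"
      proof (rule bspline_norm_le)
        fix k assume "k \<in> {K div 2..(K + int p) div 2}"
        then have "\<bar>2 * k - K\<bar> \<le> int p" using \<open>p \<ge> 3\<close> by auto
        then show "norm (s j k - s (Suc j) K) \<le> \<epsilon> / 2" using J[OF that] by simp
      qed
      then have "\<bar>bspline p (s j) K - s (Suc j) K\<bar> \<le> \<epsilon> / 2"
        by (simp add: bspline_diff bspline_const)
      then show ?thesis using \<open>\<epsilon> > 0\<close> by linarith
    qed
    ultimately show "\<exists>J. \<forall>j\<ge>J. (\<forall>k. fdiff (s j) k \<le> \<epsilon>) \<and>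
      (\<forall>K. \<bar>s (Suc j) K - bspline p (s j) K\<bar> \<le> \<epsilon>)" by blast
  qed (use \<open>p \<ge> 3\<close> mono in auto)
qed

lemma details_bound:
  assumes "p \<ge> 3" and \<omega>: "\<omega> \<in> {\<i>, -\<i>}" and "unit_speed v v1 v2 v3 M"
    and fin: "finite {k. a k \<noteq> 0}" and Pe: "Pe \<ge> 4"
    and repr: "exact_reproduction a Pe ((real p - 1) / 4)"
    and tr: "normal_transform \<omega> p a v L N s d" and conv: "transform_convergent s"
  shows "\<exists>J C. \<forall>j\<ge>J. \<forall>K. \<bar>d (Suc j) K\<bar> \<le> C * (1 / 16) ^ j"
proof -
  interpret normal_iteration v v1 v2 v3 M p s
    by (rule normal_iteration_of_transform) fact+
  define m where "m = Max (insert 0 ((\<lambda>k. nat \<bar>k\<bar>) ` {k. a k \<noteq> 0}))"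
  have m: "\<bar>k\<bar> \<le> int m" if "a k \<noteq> 0" for k
  proof -
    have "nat \<bar>k\<bar> \<le> m" unfolding m_def using fin that by (intro Max_ge) auto
    then show ?thesis by simp
  qed
  \<comment> \<open>The mask radius, one more for the rounding in \<open>K div 2\<close>, and
    \<open>p\<close> for the B-spline window.\<close>
  define R where "R = p + m + 1"
  have "R \<ge> p" by (simp add: R_def)
  from smooth_parameters[OF this]
  obtain J c B where J: "\<And>j. j \<ge> J \<Longrightarrow> smooth_step v v1 v2 v3 M p (s j) R
        (c * (1 / 2) ^ j) (B * (c * (1 / 2) ^ j)\<^sup>2) B"
      "\<And>j K. j \<ge> J \<Longrightarrow> M * \<bar>offset j K\<bar> \<le> 1 / 8"
      "\<And>j k. j \<ge> J \<Longrightarrow> \<bar>(fdiff ^^ 3) (s j) k\<bar> \<le> B * (c * (1 / 2) ^ j) ^ 3"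
    by blast
  \<comment> \<open>The constant depends on neither the level nor the index, which makes the bound
    uniform.\<close>
  define C4 where "C4 = detail_step.Cdetail M p R B a"
  have "\<bar>d (Suc j) K\<bar> \<le> (C4 * c ^ 4) * (1 / 16) ^ j" if j: "j \<ge> J" for j K
  proof -
    define h where "h = c * (1 / 2) ^ j"
    interpret smooth_step v v1 v2 v3 M p "s j" K R h "B * h\<^sup>2" B
      using J(1)[OF j] by (simp add: h_def)
    have near: "near k" if "a (K - 2 * k) \<noteq> 0" for k
    proof -
      have "\<bar>k - K div 2\<bar> \<le> int m + 1" using m[OF that] by linarith
      then show ?thesis unfolding near_def unfolding R_def by simp
    qed
    interpret detail_step v v1 v2 v3 M p "s j" K R h "B * h\<^sup>2" B a Pe \<omega>
      using fin near repr Pe \<omega> J(3)[OF j] by unfold_locales (auto simp: h_def eval_nat_numeral)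
    have M1: "M * \<bar>s (Suc j) K - base\<bar> \<le> 1 / 8"
      using J(2)[OF j, of K] by (simp add: offset_def base_def)
    have "transform_step \<omega> p a v (s j) (s (Suc j)) (d (Suc j))"
      using tr by (auto simp: normal_transform_def dest: spec[of _ "Suc j"])
    then have "v (s (Suc j) K) = predicted_point \<omega> p a (v \<circ> s j) K + d (Suc j) K *\<^sub>R normal"
      by (simp add: transform_step_def normal_def)
    moreover have "\<bar>s (Suc j) K - base\<bar> \<le> Coffset * h ^ 4"
      using ortho[of j K] by (intro offset_quartic M1) (simp add: secant_def)
    ultimately have "\<bar>d (Suc j) K\<bar> \<le> Cdetail * h ^ 4"
      by (intro detail_quartic[OF _ M1])
    also have "\<dots> = (C4 * c ^ 4) * ((1 / 2) ^ 4) ^ j"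
      by (simp add: C4_def h_def power_mult_distrib flip: power_mult) (simp add: mult.commute)
    finally show ?thesis by (simp add: eval_nat_numeral)
  qed
  then show ?thesis by blast
qed

theorem theorem4p1:
  fixes p N Pe :: nat and L :: real and \<omega> :: complex and v :: "real \<Rightarrow> complex"
    and a :: "int \<Rightarrow> real" and s d :: "nat \<Rightarrow> int \<Rightarrow> real"
  assumes "p \<ge> 3"
    and "\<omega> \<in> {\<i>, -\<i>}"
    and "closed_arclength_curve v L" and "Ck 4 v" and "strictly_convex_curve v L"
    and "int N \<ge> \<lceil>real p / 2\<rceil> + 1"
    and "finite {k. a k \<noteq> 0}"
    and "Pe \<ge> 4" and "exact_reproduction a Pe ((real p - 1) / 4)"
    and "normal_transform \<omega> p a v L N s d"
    and "transform_convergent s"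
  shows "(\<lambda>j. sup_norm (d j)) \<in> O(\<lambda>j. 2 powr (- 4 * real j))"
proof -
  obtain v1 v2 v3 M where us: "unit_speed v v1 v2 v3 M"
    using unit_speed_of_curve assms(3,4) by blast
  obtain J C where C: "\<And>j K. j \<ge> J \<Longrightarrow> \<bar>d (Suc j) K\<bar> \<le> C * (1 / 16) ^ j"
    using details_bound[OF assms(1,2) us assms(7-11)] by blast
  show ?thesis
  proof (rule bigoI)
    show "\<forall>\<^sub>F j in sequentially. norm (sup_norm (d j)) \<le> (16 * C) * norm (2 powr (- 4 * real j))"
      unfolding eventually_sequentially
    proof (intro exI[of _ "Suc J"] allI impI)
      fix j assume "j \<ge> Suc J"
      then obtain i where i: "j = Suc i" "i \<ge> J" by (cases j) auto
      \<comment> \<open>With \<open>j = Suc i\<close> the rate at level \<open>j\<close> has one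
        more factor 1/16, which \<open>16 * C\<close> compensates.\<close>
      have eq: "2 powr (- 4 * real j) = (1 / 16) * (1 / 16) ^ i"
      proof -
        have "2 powr (- 4 * real j) = (2 powr (- 4)) powr real j"
          by (simp add: powr_powr)
        also have "(2::real) powr (- 4) = 1 / 16" by (simp add: powr_minus)
        also have "(1 / 16 :: real) powr real j = (1 / 16) ^ j" by (simp add: powr_realpow)
        finally show ?thesis by (simp add: i)
      qed
      have le: "\<bar>d j K\<bar> \<le> C * (1 / 16) ^ i" for K using C[OF i(2)] by (simp add: i)
      then have "sup_norm (d j) \<le> C * (1 / 16) ^ i"
        unfolding sup_norm_def by (intro cSUP_least) auto
      \<comment> \<open>Shows that the supremum is nonnegative, so its norm is the supremum
        itself.\<close>
      moreover have "\<bar>d j 0\<bar> \<le> sup_norm (d j)"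
        unfolding sup_norm_def using le by (intro cSUP_upper bdd_aboveI2[of _ _ "C * (1 / 16) ^ i"]) auto
      ultimately show "norm (sup_norm (d j)) \<le> (16 * C) * norm (2 powr (- 4 * real j))"
        unfolding eq by simp
    qed
  qed
qed

end
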